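(* Let $\rho_L,\rho_R>0$, $v_L,v_R\in\mathbb R$, $E_{\mathrm r,L},E_{\mathrm r,R}>0$, and set $E_Z=E_{\mathrm r,Z}+\frac12\rho_Zv_Z^2$, $p_Z=\frac13E_{\mathrm r,Z}$ for $Z\in\{L,R\}$. Consider the Riemann problem $$\partial_t\rho=0,\qquad \partial_t(\rho v)+\partial_xp_{\mathrm r}=0,\qquad \partial_tE+\partial_x(vp_{\mathrm r})=0,\qquad p_{\mathrm r}=\tfrac13\big(E-\tfrac12\rho v^2\big),$$ with data $(\rho_L,v_L,E_L)$ for $x<0$ and $(\rho_R,v_R,E_R)$ for $x>0$. With $p^*$, $\lambda_L^-$ and $\lambda_R^+$ as defined in the context, the number $$\max\big(-\lambda_L^-(p^* ),\ \lambda_R^+(p^* )\big)$$ is an upper bound on the maximum wave speed in this Riemann problem.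
   Context: For $Z\in\{L,R\}$ and $p\ge0$ let $$f_Z(p)=\begin{cases}\sqrt{\frac{6}{\rho_Z}}\,\frac{p-p_Z}{\sqrt{p+p_Z}},&p\ge p_Z,\\[2pt] \sqrt{\frac{12}{\rho_Z}}\,(\sqrt p-\sqrt{p_Z}),&0\le p\le p_Z,\end{cases}\qquad \phi(p)=f_L(p)+f_R(p)+v_R-v_L.$$ The function $\phi$ is strictly increasing. If $\phi(0)>0$ (vacuum, i.e. $p_{\mathrm r}=0$, forms between the left and right waves) set $p^*=0$; otherwise $p^*\ge0$ is the unique solution of $\phi(p^* )=0$. Set $$\lambda_L^-(p^* )=-\sqrt{\frac{p_L+\max(p^*,p_L)}{6\rho_L}},\qquad \lambda_R^+(p^* )=\sqrt{\frac{p_R+\max(p^*,p_R)}{6\rho_R}}.$$ The solution meant is the self-similar (function of $x/t$) entropy weak solution consisting of a left wave (shock, across which the pressure increases from $p_L$, or rarefaction), a stationary contact at $x=0$ across which $\rho$ jumps from $\rho_L$ to $\rho_R$, and a right wave (shock, across which the pressure increases from $p_R$, or rarefaction), with $p_{\mathrm r}=0$ allowed between the two waves. The maximum wave speed is the smallest $\lambda\geq0$ such that the solution equals the left state for $x<-\lambda t$ and the right state for $x>\lambda t$. *)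

theory Defs
  imports "HOL-Analysis.Analysis"
begin

text \<open>States are written in the primitive form \<open>(\<rho>, v, E)\<close>; the conserved quantities
  are \<open>(\<rho>, \<rho> v, E)\<close>.\<close>

type_synonym state = "real \<times> real \<times> real"

fun density :: "state \<Rightarrow> real" where "density (\<rho>, v, E) = \<rho>"
fun velocity :: "state \<Rightarrow> real" where "velocity (\<rho>, v, E) = v"

fun rad_pressure :: "state \<Rightarrow> real" where
  "rad_pressure (\<rho>, v, E) = (1/3) * (E - (1/2) * \<rho> * v\<^sup>2)"

fun conserved :: "state \<Rightarrow> real \<times> real \<times> real" where
  "conserved (\<rho>, v, E) = (\<rho>, \<rho> * v, E)"

fun flux :: "state \<Rightarrow> real \<times> real \<times> real" where
  "flux (\<rho>, v, E) = (0, rad_pressure (\<rho>, v, E), v * rad_pressure (\<rho>, v, E))"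


text \<open>Points of the plane are pairs \<open>(x, t)\<close>. Test functions are \<open>C\<^sup>1\<close> with compact support
  in the whole plane, so they need not vanish at \<open>t = 0\<close>; \<open>\<psi>x\<close> and \<open>\<psi>t\<close> are the
  partial derivatives.\<close>

definition test_function ::
  "(real \<times> real \<Rightarrow> real) \<Rightarrow> (real \<times> real \<Rightarrow> real) \<Rightarrow> (real \<times> real \<Rightarrow> real) \<Rightarrow> bool" where
  "test_function \<psi> \<psi>x \<psi>t \<longleftrightarrow>
     (\<forall>z. (\<psi> has_derivative (\<lambda>h. \<psi>x z * fst h + \<psi>t z * snd h)) (at z)) \<and>
     continuous_on UNIV \<psi>x \<and> continuous_on UNIV \<psi>t \<and>
     (\<exists>K. compact K \<and> (\<forall>z. z \<notin> K \<longrightarrow> \<psi> z = 0))"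

text \<open>Weak solutions of the Cauchy problem with initial data \<open>U0\<close>. Local integrability up to
  \<open>t = 0\<close> is required explicitly because the Bochner integral of a non-integrable function
  is \<open>0\<close> by convention.\<close>

definition weak_solution :: "(real \<Rightarrow> real \<Rightarrow> state) \<Rightarrow> (real \<Rightarrow> state) \<Rightarrow> bool" where
  "weak_solution U U0 \<longleftrightarrow>
     (\<forall>K. compact K \<longrightarrow>
        set_integrable lborel (K \<inter> {z. 0 < snd z}) (\<lambda>z. conserved (U (fst z) (snd z))) \<and>
        set_integrable lborel (K \<inter> {z. 0 < snd z}) (\<lambda>z. flux (U (fst z) (snd z)))) \<and>
     (\<forall>K. compact K \<longrightarrow> set_integrable lborel K (\<lambda>x. conserved (U0 x))) \<and>
     (\<forall>\<psi> \<psi>x \<psi>t. test_function \<psi> \<psi>x \<psi>t \<longrightarrow>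
        (LINT z:{z. 0 < snd z}|lborel.
            \<psi>t z *\<^sub>R conserved (U (fst z) (snd z)) + \<psi>x z *\<^sub>R flux (U (fst z) (snd z)))
        + (LINT x|lborel. \<psi> (x, 0) *\<^sub>R conserved (U0 x)) = 0)"

definition riemann_data :: "state \<Rightarrow> state \<Rightarrow> real \<Rightarrow> state" where
  "riemann_data UL UR x = (if x < 0 then UL else UR)"


text \<open>A rarefaction occupying \<open>{a..b}\<close> in the self-similar variable \<open>\<xi> = x/t\<close>: the profile
  \<open>W\<close> is a fan \<open>R\<close>, continuous up to the edges and differentiable inside, joining \<open>S\<close> to \<open>T\<close>.
  That the fan obeys the conservation laws comes from \<open>weak_solution\<close>. The point \<open>\<xi> = 0\<close> is
  exempt because a fan reaching \<open>p = 0\<close> ends there, on the contact. The case \<open>a = b\<close>,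
  \<open>S = T\<close> is the wave of zero strength.\<close>

definition rarefaction :: "(real \<Rightarrow> state) \<Rightarrow> real \<Rightarrow> real \<Rightarrow> state \<Rightarrow> state \<Rightarrow> bool" where
  "rarefaction W a b S T \<longleftrightarrow>
     (\<exists>R. continuous_on {a..b} R \<and> (\<forall>\<xi>\<in>{a<..<b}. R differentiable (at \<xi>)) \<and>
          R a = S \<and> R b = T \<and> (\<forall>\<xi>\<in>{a..b} - {0}. W \<xi> = R \<xi>))"

text \<open>A shock sits at a single speed \<open>a = b\<close> (the value of the profile there is immaterial),
  and is admissible if the pressure increases from the outer state to the inner state.\<close>

definition admissible_shock :: "real \<Rightarrow> real \<Rightarrow> state \<Rightarrow> state \<Rightarrow> bool" where
  "admissible_shock a b Outer Inner \<longleftrightarrow> a = b \<and> rad_pressure Outer < rad_pressure Inner"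

text \<open>The left wave occupies \<open>{a..b}\<close>, the right wave \<open>{c..d}\<close>, and \<open>ML\<close>, \<open>MR\<close> are the states on
  the two sides of the contact. If a fan reaches the contact (\<open>b = 0\<close> or \<open>c = 0\<close>), the adjacent
  state is attained only as a one-sided limit.

  The jump conditions at the contact follow from \<open>weak_solution\<close>: the pressures agree, and
  so do the velocities unless the pressure vanishes. For zero pressure the velocity jump is left
  free by the jump conditions, and the inequality \<open>velocity ML \<le> velocity MR\<close> is the entropy
  inequality for the pair \<open>(- 3 ln p, - v)\<close> at a stationary discontinuity.\<close>

definition riemann_structure :: "state \<Rightarrow> state \<Rightarrow> (real \<Rightarrow> state) \<Rightarrow> bool" where
  "riemann_structure UL UR W \<longleftrightarrow>
     (\<exists>a b c d ML MR.
        a < 0 \<and> a \<le> b \<and> b \<le> 0 \<and> 0 \<le> c \<and> c \<le> d \<and> 0 < d \<and>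
        (\<forall>\<xi>. \<xi> < a \<longrightarrow> W \<xi> = UL) \<and>
        (\<forall>\<xi>. b < \<xi> \<and> \<xi> < 0 \<longrightarrow> W \<xi> = ML) \<and>
        (\<forall>\<xi>. 0 < \<xi> \<and> \<xi> < c \<longrightarrow> W \<xi> = MR) \<and>
        (\<forall>\<xi>. d < \<xi> \<longrightarrow> W \<xi> = UR) \<and>
        (admissible_shock a b UL ML \<or> rarefaction W a b UL ML) \<and>
        (admissible_shock c d UR MR \<or> rarefaction W c d MR UR) \<and>
        density ML = density UL \<and> density MR = density UR \<and>
        0 \<le> rad_pressure ML \<and> 0 \<le> rad_pressure MR \<and>
        velocity ML \<le> velocity MR)"

definition riemann_solution :: "state \<Rightarrow> state \<Rightarrow> (real \<Rightarrow> real \<Rightarrow> state) \<Rightarrow> bool" where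
  "riemann_solution UL UR U \<longleftrightarrow>
     weak_solution U (riemann_data UL UR) \<and>
     (\<exists>W. (\<forall>x t. 0 < t \<longrightarrow> U x t = W (x / t)) \<and> riemann_structure UL UR W)"

definition bounds_waves :: "state \<Rightarrow> state \<Rightarrow> (real \<Rightarrow> real \<Rightarrow> state) \<Rightarrow> real \<Rightarrow> bool" where
  "bounds_waves UL UR U l \<longleftrightarrow>
     0 \<le> l \<and> (\<forall>x t. 0 < t \<longrightarrow> (x < - l * t \<longrightarrow> U x t = UL) \<and> (l * t < x \<longrightarrow> U x t = UR))"

definition is_max_wave_speed :: "state \<Rightarrow> state \<Rightarrow> (real \<Rightarrow> real \<Rightarrow> state) \<Rightarrow> real \<Rightarrow> bool" where
  "is_max_wave_speed UL UR U s \<longleftrightarrow>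
     bounds_waves UL UR U s \<and> (\<forall>l. bounds_waves UL UR U l \<longrightarrow> s \<le> l)"


definition wave_fun :: "real \<Rightarrow> real \<Rightarrow> real \<Rightarrow> real" where
  "wave_fun \<rho>Z pZ p =
     (if pZ \<le> p then sqrt (6 / \<rho>Z) * ((p - pZ) / sqrt (p + pZ))
      else sqrt (12 / \<rho>Z) * (sqrt p - sqrt pZ))"

definition phi :: "real \<Rightarrow> real \<Rightarrow> real \<Rightarrow> real \<Rightarrow> real \<Rightarrow> real \<Rightarrow> real \<Rightarrow> real" where
  "phi \<rho>L vL pL \<rho>R vR pR p = wave_fun \<rho>L pL p + wave_fun \<rho>R pR p + vR - vL"

definition pstar :: "real \<Rightarrow> real \<Rightarrow> real \<Rightarrow> real \<Rightarrow> real \<Rightarrow> real \<Rightarrow> real" where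
  "pstar \<rho>L vL pL \<rho>R vR pR =
     (if 0 < phi \<rho>L vL pL \<rho>R vR pR 0 then 0
      else (THE p. 0 \<le> p \<and> phi \<rho>L vL pL \<rho>R vR pR p = 0))"

definition lambda_L_minus :: "real \<Rightarrow> real \<Rightarrow> real \<Rightarrow> real" where
  "lambda_L_minus \<rho>L pL p = - sqrt ((pL + max p pL) / (6 * \<rho>L))"

definition lambda_R_plus :: "real \<Rightarrow> real \<Rightarrow> real \<Rightarrow> real" where
  "lambda_R_plus \<rho>R pR p = sqrt ((pR + max p pR) / (6 * \<rho>R))"

end

theory Submission
  imports Defs
begin

text \<open>
  Why the bound holds. Write the self-similar solution as \<open>U x t = W (x / t)\<close>, with conserved
  variables \<open>u\<close> and flux \<open>F\<close> regarded as functions of \<open>\<xi> = x / t\<close>. Testing the weak formulation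
  with \<open>\<chi> t * \<eta> (x / t)\<close> and integrating out \<open>t\<close> shows that \<open>G = F - \<xi> u\<close> satisfies
  \<open>G' = - u\<close> in the sense of distributions (\<open>selfsimilar_weak_form\<close>). Letting \<open>\<eta>\<close> approximate
  the indicator of an interval turns this into the increment formula \<open>G_increment\<close>, which gives
  the Rankine--Hugoniot condition at every jump (\<open>jump_condition\<close>) and \<open>F' = \<xi> u'\<close> inside
  every fan (\<open>fan_equation\<close>).

  These relations determine both outer waves. Across a shock, eliminating the velocity jump gives
  the speed \<open>\<plusminus> sqrt ((p_M + p_Z) / (6 \<rho>_Z))\<close> (\<open>shock_relations\<close>). In a left fan the equations
  become \<open>p' = \<xi> \<rho> v'\<close> and \<open>v' (p - 3 \<rho> \<xi>\<^sup>2) = 0\<close>; hence \<open>p\<close> is non-increasing,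
  \<open>v + sqrt (12 p / \<rho>)\<close> is constant, and nothing changes before the characteristic speed
  \<open>- sqrt (p_L / (3 \<rho>_L))\<close> is reached (\<open>fan_profile\<close>); right fans are their mirror images.
  In all cases the velocities next to the contact are \<open>v_L - f_L(p_M)\<close> and \<open>v_R + f_R(p_M)\<close>,
  and the outer states persist up to the speeds \<open>\<lambda>_L^-(p_M)\<close> and \<open>\<lambda>_R^+(p_M)\<close>
  (\<open>left_wave\<close>, \<open>right_wave\<close>).

  At the contact the flux is continuous, so both sides have the same pressure \<open>p_M\<close>, and
  \<open>\<phi>(p_M)\<close> is the velocity jump: it vanishes if \<open>p_M > 0\<close> and is nonnegative if \<open>p_M = 0\<close>.
  As \<open>\<phi>\<close> is strictly increasing, \<open>p_M\<close> is the number \<open>pstar\<close> (\<open>pstar_eqI\<close>), so the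
  claimed maximum bounds the waves. The least such bound exists because the defining conditions
  involve strict inequalities and pass to the infimum (\<open>is_max_wave_speed_exists\<close>).
\<close>

section \<open>Spline test functions\<close>

lemma pos_part_sq_deriv:
  "((\<lambda>s::real. (max 0 s)\<^sup>2) has_real_derivative 2 * max 0 s) (at s)"
proof -
  consider "0 < s" | "s < 0" | "s = 0" by linarith
  then show ?thesis
  proof cases
    case 1
    have "((\<lambda>s::real. s\<^sup>2) has_real_derivative 2 * s) (at s)"
      by (auto intro!: derivative_eq_intros)
    then have "((\<lambda>s::real. (max 0 s)\<^sup>2) has_real_derivative 2 * s) (at s)"
      by (rule has_field_derivative_transform_within_open[where S = "{0<..}"]) (use 1 in auto)
    then show ?thesis using 1 by simp
  next
    case 2
    have "((\<lambda>s::real. 0) has_real_derivative 0) (at s)" by simp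
    then have "((\<lambda>s::real. (max 0 s)\<^sup>2) has_real_derivative 0) (at s)"
      by (rule has_field_derivative_transform_within_open[where S = "{..<0}"]) (use 2 in auto)
    then show ?thesis using 2 by simp
  next
    case 3
    have "((\<lambda>h::real. (max 0 h)\<^sup>2 / h) \<longlongrightarrow> 0) (at 0)"
    proof (rule Lim_null_comparison)
      show "\<forall>\<^sub>F h in at 0. norm ((max 0 h)\<^sup>2 / h) \<le> \<bar>h\<bar>"
        by (auto simp: max_def power2_eq_square)
      show "((\<lambda>h::real. \<bar>h\<bar>) \<longlongrightarrow> 0) (at 0)" by (rule tendsto_rabs_zero) auto
    qed
    then show ?thesis using 3 by (simp add: DERIV_def)
  qed
qed

text \<open>A continuously differentiable quadratic spline rising from \<open>0\<close> at \<open>s = 0\<close> to \<open>1\<close> at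
  \<open>s = 1\<close>. Its support starts at \<open>0\<close>, so rescaled copies of its derivative \<open>tent\<close>
  concentrate at a point from the right.\<close>

definition ramp :: "real \<Rightarrow> real" where
  "ramp s = 2 * ((max 0 s)\<^sup>2 - 2 * (max 0 (s - 1/2))\<^sup>2 + (max 0 (s - 1))\<^sup>2)"

text \<open>The derivative of \<open>ramp\<close>: a piecewise linear hat of unit mass on the unit interval.\<close>

definition tent :: "real \<Rightarrow> real" where
  "tent s = 4 * (max 0 s - 2 * max 0 (s - 1/2) + max 0 (s - 1))"

lemma ramp_deriv: "(ramp has_real_derivative tent s) (at s)"
proof -
  have sq: "((\<lambda>s. (max 0 (s - c))\<^sup>2) has_real_derivative 2 * max 0 (s - c)) (at s)" for c :: real
  proof -
    have "((\<lambda>s. s - c) has_real_derivative 1) (at s)" by (auto intro!: derivative_eq_intros)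
    from DERIV_chain2[OF pos_part_sq_deriv this] show ?thesis by simp
  qed
  have "((\<lambda>s. 2 * ((max 0 (s - 0))\<^sup>2 - 2 * (max 0 (s - 1/2))\<^sup>2 + (max 0 (s - 1))\<^sup>2)) has_real_derivative
      2 * (2 * max 0 (s - 0) - 2 * (2 * max 0 (s - 1/2)) + 2 * max 0 (s - 1))) (at s)"
    by (intro DERIV_cmult DERIV_add DERIV_diff sq)
  then show ?thesis
    by (simp add: ramp_def[abs_def] tent_def algebra_simps)
qed

lemma continuous_tent: "continuous_on A tent"
  unfolding tent_def[abs_def] by (intro continuous_intros)

lemma ramp_0: "s \<le> 0 \<Longrightarrow> ramp s = 0" by (simp add: ramp_def)

lemma ramp_1: "1 \<le> s \<Longrightarrow> ramp s = 1"
  by (simp add: ramp_def power2_eq_square algebra_simps)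

lemma tent_outside: "s \<le> 0 \<or> 1 \<le> s \<Longrightarrow> tent s = 0"
  by (auto simp: tent_def)

lemma tent_bounds: "0 \<le> tent s" "tent s \<le> 2"
  by (auto simp: tent_def max_def)

lemma ramp_bounds: "0 \<le> ramp s" "ramp s \<le> 1"
proof -
  have mono: "ramp x \<le> ramp y" if "x \<le> y" for x y
    by (rule DERIV_nonneg_imp_nondecreasing[OF that]) (use ramp_deriv tent_bounds in blast)
  show "0 \<le> ramp s" using mono[of "min 0 s" s] ramp_0[of "min 0 s"] by simp
  show "ramp s \<le> 1" using mono[of s "max 1 s"] ramp_1[of "max 1 s"] by simp
qed

lemma integral_tent: "(\<integral>s. tent s \<partial>lborel) = 1" and integrable_tent: "integrable lborel tent"
proof -
  have "has_bochner_integral lborel (\<lambda>x. indicator {0..1} x *\<^sub>R tent x) (ramp 1 - ramp 0)"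
    by (rule has_bochner_integral_FTC_Icc)
       (auto intro!: DERIV_subset[OF ramp_deriv] continuous_tent
             simp flip: has_real_derivative_iff_has_vector_derivative)
  moreover have "(\<lambda>x. indicator {0..1} x *\<^sub>R tent x) = tent"
    by (auto simp: fun_eq_iff indicator_def) (metis tent_outside linorder_le_cases)+
  ultimately have "has_bochner_integral lborel tent 1"
    by (simp add: ramp_0 ramp_1)
  then show "(\<integral>s. tent s \<partial>lborel) = 1" "integrable lborel tent"
    by (auto simp: has_bochner_integral_iff)
qed

text \<open>A continuously differentiable bump on the interval from \<open>1\<close> to \<open>2\<close>, used as the time
  factor of test functions; being supported away from \<open>t = 0\<close>, it removes the initial data and
  the singularity of \<open>x / t\<close>.\<close>

definition bump :: "real \<Rightarrow> real" where "bump t = (max 0 ((t - 1) * (2 - t)))\<^sup>2"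
text \<open>The derivative of \<open>bump\<close>.\<close>

definition bump' :: "real \<Rightarrow> real" where
  "bump' t = 2 * max 0 ((t - 1) * (2 - t)) * (3 - 2 * t)"

lemma bump_deriv: "(bump has_real_derivative bump' t) (at t)"
proof -
  have "((\<lambda>t::real. (t - 1) * (2 - t)) has_real_derivative 3 - 2 * t) (at t)"
    by (auto intro!: derivative_eq_intros)
  from DERIV_chain2[OF pos_part_sq_deriv this]
  show ?thesis by (simp add: bump_def[abs_def] bump'_def)
qed

lemma bump_outside: assumes "t \<le> 1 \<or> 2 \<le> t" shows "bump t = 0" "bump' t = 0"
proof -
  have "(t - 1) * (2 - t) \<le> 0" using assms by (auto simp: mult_le_0_iff)
  then show "bump t = 0" "bump' t = 0" by (simp_all add: bump_def bump'_def)
qed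

lemma continuous_bump: "continuous_on A bump" "continuous_on A bump'"
  unfolding bump_def[abs_def] bump'_def[abs_def] by (intro continuous_intros)+

lemma integral_bump:
  "has_bochner_integral lborel bump (1/30)"
  "has_bochner_integral lborel (\<lambda>t. t * bump' t) (- (1/30))"
proof -
  let ?P = "\<lambda>t::real. t^5/5 - 3*t^4/2 + 13*t^3/3 - 6*t^2 + 4*t"
  have 1: "has_bochner_integral lborel (\<lambda>x. indicator {1..2} x *\<^sub>R bump x) (?P 2 - ?P 1)"
  proof (rule has_bochner_integral_FTC_Icc)
    fix x :: real assume x: "1 \<le> x" "x \<le> 2"
    have "bump x = ((x - 1) * (2 - x))\<^sup>2" using x by (simp add: bump_def max_def)
    also have "\<dots> = x^4 - 6*x^3 + 13*x^2 - 12*x + 4"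
      by algebra
    finally show "(?P has_vector_derivative bump x) (at x within {1..2})"
      unfolding has_real_derivative_iff_has_vector_derivative[symmetric]
      by (auto intro!: derivative_eq_intros)
  qed (auto intro: continuous_bump)
  \<comment> \<open>\<open>(t * bump t)' = bump t + t * bump' t\<close> has integral \<open>0\<close>.\<close>
  have 2: "has_bochner_integral lborel (\<lambda>x. indicator {1..2} x *\<^sub>R (bump x + x * bump' x)) (2 * bump 2 - 1 * bump 1)"
    by (rule has_bochner_integral_FTC_Icc)
      (auto intro!: continuous_intros continuous_bump derivative_eq_intros
        DERIV_subset[OF bump_deriv]
        simp flip: has_real_derivative_iff_has_vector_derivative)
  have e: "(\<lambda>x. indicator {1..2} x *\<^sub>R bump x) = bump"
     "(\<lambda>x. indicator {1..2} x *\<^sub>R (bump x + x * bump' x)) = (\<lambda>x. bump x + x * bump' x)"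
    by (auto simp: fun_eq_iff indicator_def) (metis bump_outside linorder_le_cases mult_zero_right add_0)+
  show 3: "has_bochner_integral lborel bump (1/30)" using 1 unfolding e by simp
  have "has_bochner_integral lborel (\<lambda>x. bump x + x * bump' x) 0"
    using 2 unfolding e by (simp add: bump_outside)
  from has_bochner_integral_diff[OF this 3]
  show "has_bochner_integral lborel (\<lambda>t. t * bump' t) (- (1/30))" by simp
qed

section \<open>The weak form in the self-similar variable\<close>

text \<open>The test function \<open>bump t * \<eta> (x / t)\<close> separates after the substitution \<open>x = t s\<close>:
  the double integral becomes \<open>(\<integral>t * bump' t) * \<integral>\<eta> u + (\<integral>bump t) * \<integral>\<eta>' (F - s u)\<close>, and the two
  time integrals are opposite and nonzero.\<close>

lemma selfsimilar_weak_form: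
  fixes u F :: "real \<Rightarrow> 'b::{banach, second_countable_topology}"
  assumes u_meas: "u \<in> borel_measurable borel" and F_meas: "F \<in> borel_measurable borel"
    and u_bdd: "\<And>s. norm (u s) \<le> B" and F_bdd: "\<And>s. norm (F s) \<le> B"
    and weak: "\<And>\<psi> \<psi>x \<psi>t. test_function \<psi> \<psi>x \<psi>t \<Longrightarrow> (\<And>x. \<psi> (x, 0) = 0) \<Longrightarrow>
      (LINT z:{z. 0 < snd z}|lborel. \<psi>t z *\<^sub>R u (fst z / snd z) + \<psi>x z *\<^sub>R F (fst z / snd z)) = 0"
    and eta_deriv: "\<And>s. (\<eta> has_real_derivative \<eta>' s) (at s)"
    and eta'_cont: "continuous_on UNIV \<eta>'"
    and eta_supp: "\<And>s. M < \<bar>s\<bar> \<Longrightarrow> \<eta> s = 0" "\<And>s. M < \<bar>s\<bar> \<Longrightarrow> \<eta>' s = 0"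
  shows "(\<integral>s. \<eta>' s *\<^sub>R (F s - s *\<^sub>R u s) \<partial>lborel) = (\<integral>s. \<eta> s *\<^sub>R u s \<partial>lborel)"
proof -
  define \<psi> where "\<psi> z = bump (snd z) * \<eta> (fst z / snd z)" for z :: "real \<times> real"
  define \<psi>x where "\<psi>x z = bump (snd z) * \<eta>' (fst z / snd z) / snd z" for z :: "real \<times> real"
  define \<psi>t where "\<psi>t z = bump' (snd z) * \<eta> (fst z / snd z)
      - bump (snd z) * \<eta>' (fst z / snd z) * (fst z / snd z) / snd z" for z :: "real \<times> real"
  have eta_cont: "continuous_on A \<eta>" for A
    using eta_deriv by (meson DERIV_isCont continuous_at_imp_continuous_on)
  have eta'_cont': "continuous_on A \<eta>'" for A
    using eta'_cont continuous_on_subset by blast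
  have early: "\<psi> z = 0" "\<psi>x z = 0" "\<psi>t z = 0" if "snd z \<le> 1" for z
    using that by (auto simp: \<psi>_def \<psi>x_def \<psi>t_def bump_outside)
  \<comment> \<open>Two open sets cover the plane: on one \<open>x / t\<close> is smooth, on the other everything vanishes.\<close>
  define Up where "Up = {z::real \<times> real. 1/2 < snd z}"
  define Lo where "Lo = {z::real \<times> real. snd z < 1}"
  have op: "open Up" "open Lo" and cover: "Up \<union> Lo = UNIV"
    unfolding Up_def Lo_def by (auto intro!: open_Collect_less continuous_intros)
  have cont: "continuous_on UNIV f" if "continuous_on Up f" "\<And>z. z \<in> Lo \<Longrightarrow> f z = 0"
    for f :: "real \<times> real \<Rightarrow> real"
  proof -
    have "continuous_on Lo f"
      using that(2) by (subst continuous_on_cong[OF refl, of _ _ "\<lambda>_. 0"]) auto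
    from continuous_on_open_Un[OF op that(1) this] show ?thesis by (simp add: cover)
  qed
  have cont_q: "continuous_on Up (\<lambda>z. fst z / snd z)"
    by (auto intro!: continuous_intros simp: Up_def)
  have comp_q: "continuous_on Up (\<lambda>z. g (fst z / snd z))" if "continuous_on UNIV g" for g :: "real \<Rightarrow> real"
    by (rule continuous_on_compose2[OF that cont_q]) auto
  have comp_s: "continuous_on Up (\<lambda>z. g (snd z))" if "continuous_on UNIV g" for g :: "real \<Rightarrow> real"
    by (rule continuous_on_compose2[OF that]) (auto intro!: continuous_intros)
  have \<psi>x_cont: "continuous_on UNIV \<psi>x"
  proof (rule cont)
    show "continuous_on Up \<psi>x" unfolding \<psi>x_def[abs_def]
      by (intro continuous_intros comp_q comp_s eta'_cont continuous_bump) (auto simp: Up_def)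
  qed (simp add: early Lo_def)
  have \<psi>t_cont: "continuous_on UNIV \<psi>t"
  proof (rule cont)
    show "continuous_on Up \<psi>t" unfolding \<psi>t_def[abs_def]
      by (intro continuous_intros comp_q comp_s eta'_cont eta_cont continuous_bump) (auto simp: Up_def)
  qed (simp add: early Lo_def)
  have deriv: "(\<psi> has_derivative (\<lambda>h. \<psi>x z * fst h + \<psi>t z * snd h)) (at z)" for z
  proof (cases "snd z \<le> 1/2")
    case True
    have "((\<lambda>_. 0) has_derivative (\<lambda>h. 0)) (at z)" by simp
    then have "(\<psi> has_derivative (\<lambda>h. 0)) (at z)"
      by (rule has_derivative_transform_within_open[OF _ op(2)])
        (use True in \<open>auto simp: Lo_def early\<close>)
    then show ?thesis using True by (simp add: early)
  next
    case False
    then have t: "0 < snd z" by simp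
    have q: "((\<lambda>z. fst z / snd z) has_derivative
        (\<lambda>h. (1 / snd z) * fst h - (fst z / snd z / snd z) * snd h)) (at z)"
      using t by (auto intro!: derivative_eq_intros simp: field_simps power2_eq_square)
    have e: "((\<lambda>z. \<eta> (fst z / snd z)) has_derivative
        (\<lambda>h. \<eta>' (fst z / snd z) * ((1 / snd z) * fst h - (fst z / snd z / snd z) * snd h))) (at z)"
      using has_derivative_compose[OF q eta_deriv[unfolded has_field_derivative_def]] .
    have b: "((\<lambda>z. bump (snd z)) has_derivative (\<lambda>h. bump' (snd z) * snd h)) (at z)"
      by (rule has_derivative_compose[OF _ bump_deriv[unfolded has_field_derivative_def]])
        (rule bounded_linear_imp_has_derivative[OF bounded_linear_snd])
    show ?thesis
      unfolding \<psi>_def[abs_def]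
      by (rule has_derivative_eq_rhs[OF has_derivative_mult[OF b e]])
        (auto simp: fun_eq_iff \<psi>x_def \<psi>t_def algebra_simps)
  qed
  define K where "K = cbox (- 2 * \<bar>M\<bar>, 1) (2 * \<bar>M\<bar>, 2 :: real)"
  have outside: "\<psi> z = 0 \<and> \<psi>x z = 0 \<and> \<psi>t z = 0" if "z \<notin> K" for z
  proof (cases "1 \<le> snd z \<and> snd z \<le> 2")
    case True
    then have "2 * \<bar>M\<bar> < \<bar>fst z\<bar>" using that by (cases z) (auto simp: K_def cbox_Pair_eq)
    moreover have "\<bar>fst z\<bar> \<le> 2 * (\<bar>fst z\<bar> / snd z)"
      using True by (simp add: field_simps) (metis abs_ge_zero mult.commute mult_left_mono)
    ultimately have "M < \<bar>fst z / snd z\<bar>" using True by simp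
    then show ?thesis using eta_supp by (simp add: \<psi>_def \<psi>x_def \<psi>t_def)
  next
    case False
    then show ?thesis by (auto simp: \<psi>_def \<psi>x_def \<psi>t_def bump_outside)
  qed
  have test: "test_function \<psi> \<psi>x \<psi>t"
    unfolding test_function_def using deriv \<psi>x_cont \<psi>t_cont outside
    by (auto intro!: exI[of _ K] simp: K_def)
  define f where "f x t = \<psi>t (x, t) *\<^sub>R u (x / t) + \<psi>x (x, t) *\<^sub>R F (x / t)" for x t
  have zero: "(\<integral>z. case_prod f z \<partial>lborel) = 0"
  proof -
    have "(\<integral>z. case_prod f z \<partial>lborel) =
      (LINT z:{z. 0 < snd z}|lborel. \<psi>t z *\<^sub>R u (fst z / snd z) + \<psi>x z *\<^sub>R F (fst z / snd z))"
      unfolding set_lebesgue_integral_def f_def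
      by (rule Bochner_Integration.integral_cong) (auto simp: indicator_def early)
    also have "\<dots> = 0" by (rule weak[OF test]) (simp add: early)
    finally show ?thesis .
  qed
  have bdd: "\<exists>C. \<forall>z. \<bar>g z\<bar> \<le> C" if c: "continuous_on UNIV g" and o: "\<And>z. z \<notin> K \<Longrightarrow> g z = 0"
    for g :: "real \<times> real \<Rightarrow> real"
  proof -
    have "bounded (g ` K)" using c
      by (intro compact_imp_bounded compact_continuous_image) (auto simp: K_def intro: continuous_on_subset)
    then obtain C where C: "\<And>z. z \<in> K \<Longrightarrow> \<bar>g z\<bar> \<le> C"
      unfolding bounded_iff by (metis imageI real_norm_def)
    have "\<bar>g z\<bar> \<le> max C 0" for z using C[of z] o[of z] by (cases "z \<in> K") auto
    then show ?thesis by blast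
  qed
  obtain C1 where C1: "\<And>z. \<bar>\<psi>t z\<bar> \<le> C1" using bdd[of \<psi>t] \<psi>t_cont outside by blast
  obtain C2 where C2: "\<And>z. \<bar>\<psi>x z\<bar> \<le> C2" using bdd[of \<psi>x] \<psi>x_cont outside by blast
  have [measurable]: "u \<in> borel_measurable borel" "F \<in> borel_measurable borel"
      "\<psi>x \<in> borel_measurable borel" "\<psi>t \<in> borel_measurable borel" 
    using u_meas F_meas \<psi>x_cont \<psi>t_cont by (auto intro: borel_measurable_continuous_onI)
  have f_int: "integrable lborel (case_prod f)"
  proof (rule Bochner_Integration.integrable_bound)
    show "integrable lborel (\<lambda>z. indicator K z * (C1 * B + C2 * B))"
      by (intro integrable_mult_left integrable_real_indicator)
        (auto simp: K_def emeasure_lborel_cbox_eq)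
    have "case_prod f = (\<lambda>z. \<psi>t z *\<^sub>R u (fst z / snd z) + \<psi>x z *\<^sub>R F (fst z / snd z))"
      by (auto simp: f_def)
    moreover have q: "(\<lambda>z::real \<times> real. fst z / snd z) \<in> borel_measurable borel"
      by (intro borel_measurable_divide borel_measurable_continuous_onI continuous_intros)
    ultimately show "case_prod f \<in> borel_measurable lborel"
      using measurable_compose[OF q u_meas] measurable_compose[OF q F_meas] by simp
    have "norm (case_prod f z) \<le> norm (indicator K z * (C1 * B + C2 * B))" for z
    proof (cases "z \<in> K")
      case True
      have B: "0 \<le> B" using u_bdd[of 0] norm_ge_zero order_trans by blast
      have C: "0 \<le> C1" "0 \<le> C2" using C1[of 0] C2[of 0] by linarith+
      have "norm (case_prod f z) \<le> \<bar>\<psi>t z\<bar> * norm (u (fst z / snd z)) + \<bar>\<psi>x z\<bar> * norm (F (fst z / snd z))"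
        by (auto simp: f_def split: prod.split intro!: norm_triangle_le)
      also have "\<dots> \<le> C1 * B + C2 * B"
        by (intro add_mono mult_mono C1 C2 u_bdd F_bdd C) auto
      finally show ?thesis using True by simp
    next
      case False
      then show ?thesis using outside by (auto simp: f_def split: prod.split)
    qed
    then show "AE z in lborel. norm (case_prod f z) \<le> norm (indicator K z * (C1 * B + C2 * B))"
      by simp
  qed
  have B0: "0 \<le> B" using u_bdd[of 0] norm_ge_zero order_trans by blast
  have eta_bdd: "integrable lborel (\<lambda>s. g s *\<^sub>R w s)"
    if g: "continuous_on UNIV g" "\<And>s. M < \<bar>s\<bar> \<Longrightarrow> g s = 0"
      and w: "w \<in> borel_measurable borel" "\<And>s. norm (w s) \<le> B * (1 + \<bar>s\<bar>)"
    for g :: "real \<Rightarrow> real" and w :: "real \<Rightarrow> 'b"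
  proof (rule Bochner_Integration.integrable_bound)
    show "integrable lborel (\<lambda>s. indicator {- \<bar>M\<bar>..\<bar>M\<bar>} s *\<^sub>R (g s * (B * (1 + \<bar>s\<bar>))))"
      by (rule borel_integrable_compact) (auto intro!: continuous_intros continuous_on_subset[OF g(1)])
    show "(\<lambda>s. g s *\<^sub>R w s) \<in> borel_measurable lborel"
      using borel_measurable_scaleR[OF borel_measurable_continuous_onI[OF g(1)] w(1)] by simp
    have "norm (g s *\<^sub>R w s) \<le> norm (indicator {- \<bar>M\<bar>..\<bar>M\<bar>} s *\<^sub>R (g s * (B * (1 + \<bar>s\<bar>))))" for s
    proof (cases "M < \<bar>s\<bar>")
      case False
      then have "s \<in> {- \<bar>M\<bar>..\<bar>M\<bar>}" by auto
      then show ?thesis using w(2)[of s] B0 by (auto simp: abs_mult intro!: mult_left_mono)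
    qed (simp add: g)
    then show "AE s in lborel. norm (g s *\<^sub>R w s) \<le> norm (indicator {- \<bar>M\<bar>..\<bar>M\<bar>} s *\<^sub>R (g s * (B * (1 + \<bar>s\<bar>))))"
      by simp
  qed
  define P where "P = (\<integral>s. \<eta> s *\<^sub>R u s \<partial>lborel)"
  define Q where "Q = (\<integral>s. \<eta>' s *\<^sub>R (F s - s *\<^sub>R u s) \<partial>lborel)"
  have intP: "integrable lborel (\<lambda>s. \<eta> s *\<^sub>R u s)"
  proof (rule eta_bdd[OF eta_cont eta_supp(1) u_meas])
    show "norm (u s) \<le> B * (1 + \<bar>s\<bar>)" for s
      using u_bdd[of s] mult_nonneg_nonneg[OF B0, of "\<bar>s\<bar>"] by (simp add: algebra_simps)
  qed
  have intQ: "integrable lborel (\<lambda>s. \<eta>' s *\<^sub>R (F s - s *\<^sub>R u s))"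
  proof (rule eta_bdd[OF eta'_cont eta_supp(2)])
    show "(\<lambda>s. F s - s *\<^sub>R u s) \<in> borel_measurable borel" by simp
    show "norm (F s - s *\<^sub>R u s) \<le> B * (1 + \<bar>s\<bar>)" for s
      using norm_triangle_ineq4[of "F s" "s *\<^sub>R u s"] F_bdd[of s] mult_left_mono[OF u_bdd[of s], of "\<bar>s\<bar>"]
      by (simp add: algebra_simps)
  qed
  have inner: "(\<integral>x. f x t \<partial>lborel) = (t * bump' t) *\<^sub>R P + bump t *\<^sub>R Q" for t
  proof (cases "t \<le> 1")
    case True
    then show ?thesis by (simp add: f_def early bump_outside)
  next
    case False
    then have t: "0 < t" by simp
    have "(\<integral>x. f x t \<partial>lborel) = t *\<^sub>R (\<integral>s. f (t * s) t \<partial>lborel)"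
      using lborel_integral_real_affine[of t "\<lambda>x. f x t" 0] t by simp
    also have "(\<integral>s. f (t * s) t \<partial>lborel) =
       (\<integral>s. bump' t *\<^sub>R (\<eta> s *\<^sub>R u s) + (bump t / t) *\<^sub>R (\<eta>' s *\<^sub>R (F s - s *\<^sub>R u s)) \<partial>lborel)"
      using t by (intro Bochner_Integration.integral_cong)
        (auto simp: f_def \<psi>t_def \<psi>x_def algebra_simps)
    also have "\<dots> = bump' t *\<^sub>R P + (bump t / t) *\<^sub>R Q"
      unfolding P_def Q_def
      by (simp only: Bochner_Integration.integral_add[OF integrable_scaleR_right[OF intP]
          integrable_scaleR_right[OF intQ]] integral_scaleR_right)
    finally show ?thesis using t by (simp add: algebra_simps)
  qed
  have "(\<integral>t. (\<integral>x. f x t \<partial>lborel) \<partial>lborel) = integral\<^sup>L (lborel \<Otimes>\<^sub>M lborel) (case_prod f)"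
    by (rule lborel_pair.integral_snd) (use f_int in \<open>simp add: lborel_prod\<close>)
  also have "\<dots> = 0" using zero by (simp add: lborel_prod)
  finally have 0: "(\<integral>t. (t * bump' t) *\<^sub>R P + bump t *\<^sub>R Q \<partial>lborel) = 0" by (simp add: inner)
  have "has_bochner_integral lborel (\<lambda>t. (t * bump' t) *\<^sub>R P + bump t *\<^sub>R Q)
      ((- (1/30)) *\<^sub>R P + (1/30) *\<^sub>R Q)"
    by (intro has_bochner_integral_add has_bochner_integral_scaleR_left integral_bump)
  then have "(- (1/30::real)) *\<^sub>R P + (1/30) *\<^sub>R Q = 0"
    using 0 by (simp add: has_bochner_integral_iff)
  then have "(1/30::real) *\<^sub>R (Q - P) = 0" by (simp add: algebra_simps)
  then show ?thesis unfolding P_def[symmetric] Q_def[symmetric] by simp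
qed

text \<open>Only the right limit of \<open>G\<close> at \<open>\<alpha>\<close> matters, as \<open>tent\<close> vanishes on the negative axis.\<close>

lemma tent_concentrates:
  fixes G :: "real \<Rightarrow> 'b::{banach, second_countable_topology}"
  assumes meas: "G \<in> borel_measurable borel" and bdd: "\<And>s. norm (G s) \<le> B * (1 + \<bar>s\<bar>)"
    and lim: "(G \<longlongrightarrow> g) (at_right \<alpha>)"
  shows "(\<lambda>n. \<integral>s. (real (Suc n) * tent (real (Suc n) * (s - \<alpha>))) *\<^sub>R G s \<partial>lborel) \<longlonglongrightarrow> g"
proof -
  have B: "0 \<le> B" using order_trans[OF norm_ge_zero bdd[of 0]] by simp
  have eq: "(\<integral>s. (real (Suc n) * tent (real (Suc n) * (s - \<alpha>))) *\<^sub>R G s \<partial>lborel)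
      = (\<integral>x. tent x *\<^sub>R G (\<alpha> + x / real (Suc n)) \<partial>lborel)" for n
  proof -
    have "(\<integral>s. (real (Suc n) * tent (real (Suc n) * (s - \<alpha>))) *\<^sub>R G s \<partial>lborel)
      = (1 / real (Suc n)) *\<^sub>R (\<integral>x. real (Suc n) *\<^sub>R (tent x *\<^sub>R G (\<alpha> + x / real (Suc n))) \<partial>lborel)"
      using lborel_integral_real_affine[of "1 / real (Suc n)"
        "\<lambda>s. (real (Suc n) * tent (real (Suc n) * (s - \<alpha>))) *\<^sub>R G s" \<alpha>]
      by (simp del: of_nat_Suc)
    also have "\<dots> = (1 / real (Suc n)) *\<^sub>R real (Suc n) *\<^sub>R (\<integral>x. tent x *\<^sub>R G (\<alpha> + x / real (Suc n)) \<partial>lborel)"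
      by (simp only: integral_scaleR_right)
    finally show ?thesis by (simp del: of_nat_Suc)
  qed
  have [measurable]: "tent \<in> borel_measurable borel"
    by (intro borel_measurable_continuous_onI continuous_tent)
  note [measurable] = meas
  have "(\<lambda>n. \<integral>x. tent x *\<^sub>R G (\<alpha> + x / real (Suc n)) \<partial>lborel) \<longlonglongrightarrow> (\<integral>x. tent x *\<^sub>R g \<partial>lborel)"
  proof (rule integral_dominated_convergence)
    show "integrable lborel (\<lambda>x. tent x * (B * (2 + \<bar>\<alpha>\<bar>)))"
      by (intro integrable_mult_left) (rule integrable_tent)
    have "(\<lambda>n. tent x *\<^sub>R G (\<alpha> + x / real (Suc n))) \<longlonglongrightarrow> tent x *\<^sub>R g" for x
    proof (cases "0 < x")
      case True
      have "(\<lambda>n. \<alpha> + x / real (Suc n)) \<longlonglongrightarrow> \<alpha> + 0"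
        by (intro tendsto_add tendsto_const LIMSEQ_Suc[OF lim_const_over_n])
      then have "filterlim (\<lambda>n. \<alpha> + x / real (Suc n)) (at_right \<alpha>) sequentially"
        using True by (auto simp: filterlim_at intro!: always_eventually)
      from filterlim_compose[OF lim this] show ?thesis by (intro tendsto_intros)
    qed (simp add: tent_outside)
    then show "AE x in lborel. (\<lambda>n. tent x *\<^sub>R G (\<alpha> + x / real (Suc n))) \<longlonglongrightarrow> tent x *\<^sub>R g"
      by simp
    have "norm (tent x *\<^sub>R G (\<alpha> + x / real (Suc n))) \<le> tent x * (B * (2 + \<bar>\<alpha>\<bar>))" for x n
    proof (cases "0 < x \<and> x < 1")
      case True
      have "\<bar>\<alpha> + x / real (Suc n)\<bar> \<le> \<bar>\<alpha>\<bar> + \<bar>x / real (Suc n)\<bar>" by (rule abs_triangle_ineq)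
      also have "\<bar>x / real (Suc n)\<bar> \<le> 1" using True by (simp add: divide_le_eq)
      finally have "B * (1 + \<bar>\<alpha> + x / real (Suc n)\<bar>) \<le> B * (2 + \<bar>\<alpha>\<bar>)"
        using B by (intro mult_left_mono) auto
      with bdd[of "\<alpha> + x / real (Suc n)"] show ?thesis
        using tent_bounds[of x] by (auto intro!: mult_left_mono)
    qed (auto simp: tent_outside not_less)
    then show "AE x in lborel. norm (tent x *\<^sub>R G (\<alpha> + x / real (Suc n))) \<le> tent x * (B * (2 + \<bar>\<alpha>\<bar>))" for n
      by simp
  qed simp_all
  then show ?thesis using integrable_tent by (simp add: eq integral_tent del: of_nat_Suc)
qed

lemma ramp_limit:
  assumes "s \<noteq> \<alpha>"
  shows "(\<lambda>n. ramp (real (Suc n) * (s - \<alpha>))) \<longlonglongrightarrow> (if \<alpha> < s then 1 else 0)"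
proof (cases "\<alpha> < s")
  case True
  then obtain N :: nat where N: "1 < real N * (s - \<alpha>)"
    using reals_Archimedean3[of "s - \<alpha>"] by auto
  have "ramp (real (Suc n) * (s - \<alpha>)) = 1" if "N \<le> n" for n
  proof -
    have "real N * (s - \<alpha>) \<le> real (Suc n) * (s - \<alpha>)"
      using that True by (intro mult_right_mono) auto
    then show ?thesis using N by (intro ramp_1) linarith
  qed
  then have "\<forall>\<^sub>F n in sequentially. ramp (real (Suc n) * (s - \<alpha>)) = 1"
    by (auto simp: eventually_sequentially)
  then show ?thesis using True by (simp add: tendsto_eventually)
next
  case False
  then have "ramp (real (Suc n) * (s - \<alpha>)) = 0" for n
    by (intro ramp_0 mult_nonneg_nonpos) auto
  then show ?thesis using False by simp
qed

text \<open>Bounded measurable profiles \<open>u\<close> and \<open>F\<close> with \<open>(F - s u)' = - u\<close> in the sense of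
  distributions. The constant \<open>B\<close> bounds both of them.\<close>

locale weak_profile =
  fixes u F :: "real \<Rightarrow> 'b::euclidean_space" and B :: real
  assumes u_meas: "u \<in> borel_measurable borel" and F_meas: "F \<in> borel_measurable borel"
    and u_bdd: "norm (u s) \<le> B" and F_bdd: "norm (F s) \<le> B"
    and weak_form: "\<lbrakk>\<And>s. (\<eta> has_real_derivative \<eta>' s) (at s); continuous_on UNIV \<eta>';
        \<And>s. M < \<bar>s\<bar> \<Longrightarrow> \<eta> s = 0; \<And>s. M < \<bar>s\<bar> \<Longrightarrow> \<eta>' s = 0\<rbrakk> \<Longrightarrow>
      (\<integral>s. \<eta>' s *\<^sub>R (F s - s *\<^sub>R u s) \<partial>lborel) = (\<integral>s. \<eta> s *\<^sub>R u s \<partial>lborel)"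
begin

text \<open>The flux relative to the ray of slope \<open>s\<close>.\<close>

definition G :: "real \<Rightarrow> 'b" where "G s = F s - s *\<^sub>R u s"

lemma B_nonneg: "0 \<le> B" using u_bdd[of 0] norm_ge_zero order_trans by blast

lemma G_meas: "G \<in> borel_measurable borel"
  using u_meas F_meas unfolding G_def[abs_def] by simp

lemma G_bdd: "norm (G s) \<le> B * (1 + \<bar>s\<bar>)"
  using norm_triangle_ineq4[of "F s" "s *\<^sub>R u s"] F_bdd[of s] mult_left_mono[OF u_bdd[of s], of "\<bar>s\<bar>"]
  by (simp add: algebra_simps G_def)

text \<open>Tested with a difference of two steep ramps, whose derivative concentrates just to the right
  of \<open>\<alpha>\<close> and of \<open>\<beta>\<close> while the function itself tends to the indicator of the interval.\<close>

lemma G_increment: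
  assumes "\<alpha> < \<beta>" and ga: "(G \<longlongrightarrow> ga) (at_right \<alpha>)" and gb: "(G \<longlongrightarrow> gb) (at_right \<beta>)"
  shows "gb - ga = - (LINT s:{\<alpha>..\<beta>}|lborel. u s)"
proof -
  let ?N = "\<lambda>n. real (Suc n)"
  define \<eta> where "\<eta> n s = ramp (?N n * (s - \<alpha>)) - ramp (?N n * (s - \<beta>))" for n s
  define \<eta>' where "\<eta>' n s = ?N n * tent (?N n * (s - \<alpha>)) - ?N n * tent (?N n * (s - \<beta>))" for n s
  have der: "(\<eta> n has_real_derivative \<eta>' n s) (at s)" for n s
  proof -
    have "((\<lambda>s. ramp (?N n * (s - c))) has_real_derivative tent (?N n * (s - c)) * ?N n) (at s)" for c
      by (rule DERIV_chain2[OF ramp_deriv]) (auto intro!: derivative_eq_intros)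
    then show ?thesis unfolding \<eta>_def[abs_def] \<eta>'_def
      by (auto intro!: DERIV_diff simp: mult.commute simp del: of_nat_Suc)
  qed
  have left: "?N n * (s - c) \<le> 0" if "s \<le> c" for n s c
    using that by (intro mult_nonneg_nonpos) auto
  have right: "1 \<le> ?N n * (s - c)" if "c + 1 \<le> s" for n s c
    using mult_mono[of 1 "?N n" 1 "s - c"] that by simp
  have supp: "\<eta> n s = 0 \<and> \<eta>' n s = 0" if "s < \<alpha> \<or> \<beta> + 1 < s" for n s
  proof (cases "s < \<alpha>")
    case True
    then have *: "?N n * (s - \<alpha>) \<le> 0" "?N n * (s - \<beta>) \<le> 0"
      using \<open>\<alpha> < \<beta>\<close> left[of s \<alpha> n] left[of s \<beta> n] by linarith+
    then show ?thesis by (simp add: \<eta>_def \<eta>'_def ramp_0 tent_outside del: of_nat_Suc)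
  next
    case False
    then have *: "1 \<le> ?N n * (s - \<alpha>)" "1 \<le> ?N n * (s - \<beta>)" 
      using that \<open>\<alpha> < \<beta>\<close> right[of \<alpha> s n] right[of \<beta> s n] by linarith+
    then show ?thesis by (simp add: \<eta>_def \<eta>'_def ramp_1 tent_outside del: of_nat_Suc)
  qed
  have eq: "(\<integral>s. \<eta>' n s *\<^sub>R G s \<partial>lborel) = (\<integral>s. \<eta> n s *\<^sub>R u s \<partial>lborel)" for n
    unfolding G_def
  proof (rule weak_form[OF der])
    show "continuous_on UNIV (\<eta>' n)" unfolding \<eta>'_def
      by (intro continuous_intros continuous_on_compose2[OF continuous_tent[of UNIV]]) auto
    show "\<eta> n s = 0" "\<eta>' n s = 0" if "\<bar>\<alpha>\<bar> + \<bar>\<beta>\<bar> + 1 < \<bar>s\<bar>" for s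
      using supp[of s n] that by linarith+
  qed
  have int: "integrable lborel (\<lambda>s. (?N n * tent (?N n * (s - c))) *\<^sub>R G s)" for n c
  proof (rule Bochner_Integration.integrable_bound)
    show "integrable lborel (\<lambda>s. indicator {c..c + 1} s *\<^sub>R (?N n * 2 * (B * (1 + \<bar>s\<bar>))))"
      by (rule borel_integrable_compact) (auto intro!: continuous_intros)
    show "(\<lambda>s. (?N n * tent (?N n * (s - c))) *\<^sub>R G s) \<in> borel_measurable lborel"
      using G_meas borel_measurable_continuous_onI[OF continuous_tent] by measurable
    have "norm ((?N n * tent (?N n * (s - c))) *\<^sub>R G s)
        \<le> norm (indicator {c..c + 1} s *\<^sub>R (?N n * 2 * (B * (1 + \<bar>s\<bar>))))" for s
    proof (cases "c \<le> s \<and> s \<le> c + 1")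
      case True
      have "norm ((?N n * tent (?N n * (s - c))) *\<^sub>R G s) = ?N n * tent (?N n * (s - c)) * norm (G s)"
        using tent_bounds by (simp add: abs_mult)
      also have "\<dots> \<le> ?N n * 2 * (B * (1 + \<bar>s\<bar>))"
        using tent_bounds G_bdd B_nonneg by (intro mult_mono mult_nonneg_nonneg) auto
      finally show ?thesis using True by simp
    next
      case False
      then have "tent (?N n * (s - c)) = 0"
        using left[of s c n] right[of c s n] by (intro tent_outside) linarith
      then show ?thesis by simp
    qed
    then show "AE s in lborel. norm ((?N n * tent (?N n * (s - c))) *\<^sub>R G s)
        \<le> norm (indicator {c..c + 1} s *\<^sub>R (?N n * 2 * (B * (1 + \<bar>s\<bar>))))" by simp
  qed
  have "(\<lambda>n. \<integral>s. \<eta>' n s *\<^sub>R G s \<partial>lborel) \<longlonglongrightarrow> ga - gb"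
  proof -
    have "(\<integral>s. \<eta>' n s *\<^sub>R G s \<partial>lborel) = (\<integral>s. (?N n * tent (?N n * (s - \<alpha>))) *\<^sub>R G s \<partial>lborel)
        - (\<integral>s. (?N n * tent (?N n * (s - \<beta>))) *\<^sub>R G s \<partial>lborel)" for n
      unfolding \<eta>'_def scaleR_left_diff_distrib
      by (rule Bochner_Integration.integral_diff[OF int int])
    then show ?thesis
      using tendsto_diff[OF tent_concentrates[OF G_meas G_bdd ga] tent_concentrates[OF G_meas G_bdd gb]]
      by (simp del: of_nat_Suc)
  qed
  moreover have "(\<lambda>n. \<integral>s. \<eta> n s *\<^sub>R u s \<partial>lborel) \<longlonglongrightarrow> (\<integral>s. indicator {\<alpha>..\<beta>} s *\<^sub>R u s \<partial>lborel)"
  proof (rule integral_dominated_convergence)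
    show "integrable lborel (\<lambda>s. indicator {\<alpha>..\<beta> + 1} s * B)"
      by (intro integrable_mult_left integrable_real_indicator) (auto simp: emeasure_lborel_Icc_eq)
    show "AE s in lborel. (\<lambda>n. \<eta> n s *\<^sub>R u s) \<longlonglongrightarrow> indicator {\<alpha>..\<beta>} s *\<^sub>R u s"
      using AE_lborel_singleton[of \<alpha>] AE_lborel_singleton[of \<beta>]
    proof eventually_elim
      case (elim s)
      have "(\<lambda>n. \<eta> n s) \<longlonglongrightarrow> (if \<alpha> < s then 1 else 0) - (if \<beta> < s then 1 else 0)"
        unfolding \<eta>_def by (intro tendsto_diff ramp_limit elim)
      also have "(if \<alpha> < s then 1 else 0) - (if \<beta> < s then 1 else 0) = (indicator {\<alpha>..\<beta>} s :: real)"
        using elim \<open>\<alpha> < \<beta>\<close> by (auto simp: indicator_def)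
      finally show ?case by (intro tendsto_intros)
    qed
    have "norm (\<eta> n s *\<^sub>R u s) \<le> indicator {\<alpha>..\<beta> + 1} s * B" for n s
    proof (cases "\<alpha> \<le> s \<and> s \<le> \<beta> + 1")
      case True
      have "\<bar>\<eta> n s\<bar> \<le> 1"
        using ramp_bounds[of "?N n * (s - \<alpha>)"] ramp_bounds[of "?N n * (s - \<beta>)"] 
        unfolding \<eta>_def by linarith
      then have "\<bar>\<eta> n s\<bar> * norm (u s) \<le> 1 * B" by (intro mult_mono u_bdd) auto
      then show ?thesis using True by simp
    next
      case False
      then have "\<eta> n s = 0" using supp[of s n] by auto
      then show ?thesis using False by auto
    qed
    then show "AE s in lborel. norm (\<eta> n s *\<^sub>R u s) \<le> indicator {\<alpha>..\<beta> + 1} s * B" for n by simp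
    have "\<eta> n \<in> borel_measurable borel" for n
      using der by (intro borel_measurable_continuous_onI) (meson DERIV_isCont continuous_at_imp_continuous_on)
    then show "(\<lambda>s. \<eta> n s *\<^sub>R u s) \<in> borel_measurable lborel" for n
      using u_meas by measurable
    show "(\<lambda>s. indicator {\<alpha>..\<beta>} s *\<^sub>R u s) \<in> borel_measurable lborel"
      using u_meas by measurable
  qed
  ultimately have "ga - gb = (\<integral>s. indicator {\<alpha>..\<beta>} s *\<^sub>R u s \<partial>lborel)"
    unfolding eq using LIMSEQ_unique by blast
  then show ?thesis by (simp add: set_lebesgue_integral_def algebra_simps)
qed

lemma G_tendsto:
  assumes "(u \<longlongrightarrow> u0) (at s within S)" "(F \<longlongrightarrow> F0) (at s within S)"
  shows "(G \<longlongrightarrow> F0 - s *\<^sub>R u0) (at s within S)"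
  unfolding G_def[abs_def] using assms by (intro tendsto_intros)

text \<open>The increment of \<open>G\<close> over \<open>{\<alpha>..s}\<close> is at most \<open>B * (s - \<alpha>)\<close>, so \<open>G\<close> cannot jump.
  Continuity to the left of \<open>s\<close> serves to identify \<open>G \<alpha>\<close> with its right limit.\<close>

lemma jump_condition:
  assumes ul: "(u \<longlongrightarrow> ul) (at_left s)" and Fl: "(F \<longlongrightarrow> Fl) (at_left s)"
    and ur: "(u \<longlongrightarrow> ur) (at_right s)" and Fr: "(F \<longlongrightarrow> Fr) (at_right s)"
    and cont: "\<forall>\<^sub>F \<alpha> in at_left s. isCont u \<alpha> \<and> isCont F \<alpha>"
  shows "Fr - Fl = s *\<^sub>R (ur - ul)"
proof -
  let ?gl = "Fl - s *\<^sub>R ul" and ?gr = "Fr - s *\<^sub>R ur"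
  have "\<forall>\<^sub>F \<alpha> in at_left s. norm (?gr - G \<alpha>) \<le> B * (s - \<alpha>)"
    using cont eventually_at_left_real[of "s - 1" s, simplified]
  proof eventually_elim
    case (elim \<alpha>)
    then have "(G \<longlongrightarrow> G \<alpha>) (at_right \<alpha>)"
      unfolding G_def[of \<alpha>] by (intro G_tendsto) (auto simp: isCont_def filterlim_at_split)
    from G_increment[OF _ this G_tendsto[OF ur Fr]] elim
    have "norm (?gr - G \<alpha>) = norm (LINT s:{\<alpha>..s}|lborel. u s)" by simp
    also have "\<dots> \<le> (LINT x|lborel. indicator {\<alpha>..s} x * B)"
      unfolding set_lebesgue_integral_def
    proof (rule Bochner_Integration.integral_norm_bound_integral)
      show i: "integrable lborel (\<lambda>x. indicator {\<alpha>..s} x * B)"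
        by (intro integrable_mult_left integrable_real_indicator) (auto simp: emeasure_lborel_Icc_eq)
      have *: "norm (indicator {\<alpha>..s} x *\<^sub>R u x) \<le> indicator {\<alpha>..s} x * B" for x
        using u_bdd[of x] by (auto simp: indicator_def)
      then show "norm (indicator {\<alpha>..s} x *\<^sub>R u x) \<le> indicator {\<alpha>..s} x * B" for x .
      show "integrable lborel (\<lambda>x. indicator {\<alpha>..s} x *\<^sub>R u x)"
        by (rule Bochner_Integration.integrable_bound[OF i])
          (use u_meas B_nonneg * in \<open>auto intro!: always_eventually simp: abs_mult\<close>)
    qed
    also have "\<dots> = B * (s - \<alpha>)" using elim by simp
    finally show ?case .
  qed
  moreover have "((\<lambda>\<alpha>. norm (?gr - G \<alpha>)) \<longlongrightarrow> norm (?gr - ?gl)) (at_left s)"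
    by (intro tendsto_intros G_tendsto ul Fl)
  moreover have "((\<lambda>\<alpha>. B * (s - \<alpha>)) \<longlongrightarrow> B * (s - s)) (at_left s)"
    by (intro tendsto_intros)
  ultimately have "norm (?gr - ?gl) \<le> B * (s - s)"
    by (intro tendsto_le[OF _ _ _]) auto
  then show ?thesis by (simp add: algebra_simps)
qed

lemma fan_equation:
  assumes u: "continuous_on {a<..<b} u" and F: "continuous_on {a<..<b} F" and x: "x \<in> {a<..<b}"
  shows "(G has_vector_derivative - u x) (at x)"
proof -
  obtain \<alpha> where \<alpha>: "a < \<alpha>" "\<alpha> < x" using x dense by auto
  obtain \<beta> where \<beta>: "x < \<beta>" "\<beta> < b" using x dense by auto
  have G: "(G \<longlongrightarrow> G y) (at_right y)" if "y \<in> {a<..<b}" for y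
    using u F that unfolding G_def[of y]
    by (intro G_tendsto) (auto simp: continuous_on_eq_continuous_at isCont_def filterlim_at_split)
  have cu: "continuous_on {\<alpha>..\<beta>} u" by (rule continuous_on_subset[OF u]) (use \<alpha> \<beta> in auto)
  have eq: "G \<alpha> - integral {\<alpha>..y} u = G y" if "y \<in> {\<alpha><..<\<beta>}" for y
  proof -
    have "set_integrable lborel {\<alpha>..y} u"
      by (rule borel_integrable_atLeastAtMost') (use cu that in \<open>auto intro: continuous_on_subset\<close>)
    from set_borel_integral_eq_integral(2)[OF this]
    show ?thesis using G_increment[OF _ G G, of \<alpha> y] that \<alpha> \<beta> by (auto simp: algebra_simps)
  qed
  have "((\<lambda>y. integral {\<alpha>..y} u) has_vector_derivative u x) (at x within {\<alpha>..\<beta>})"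
    by (rule integral_has_vector_derivative[OF cu]) (use \<alpha> \<beta> in auto)
  then have "((\<lambda>y. integral {\<alpha>..y} u) has_vector_derivative u x) (at x)"
    using \<alpha> \<beta> by (simp add: at_within_Icc_at)
  from has_vector_derivative_diff[OF has_vector_derivative_const this, of "G \<alpha>"]
  have "((\<lambda>y. G \<alpha> - integral {\<alpha>..y} u) has_vector_derivative - u x) (at x)" by simp
  then show ?thesis
    by (rule has_vector_derivative_transform_within_open[where S = "{\<alpha><..<\<beta>}"]) (use eq \<alpha> \<beta> in auto)
qed

end

section \<open>The wave functions and the pressure between the waves\<close>

text \<open>The shock branch, written as pressure jump over mass flux: the square root is the shock
  speed.\<close>

lemma wave_fun_above:
  assumes "0 < \<rho>Z" "0 < pZ" "pZ \<le> p"
  shows "wave_fun \<rho>Z pZ p = (p - pZ) / (\<rho>Z * sqrt ((p + pZ) / (6 * \<rho>Z)))"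
proof -
  have "sqrt (6 / \<rho>Z) * (\<rho>Z * sqrt ((p + pZ) / (6 * \<rho>Z)))
      = sqrt (6 / \<rho>Z * (\<rho>Z\<^sup>2 * ((p + pZ) / (6 * \<rho>Z))))"
    using assms by (simp only: real_sqrt_mult real_sqrt_abs)
  also have "6 / \<rho>Z * (\<rho>Z\<^sup>2 * ((p + pZ) / (6 * \<rho>Z))) = p + pZ"
    using assms by (simp add: field_simps power2_eq_square)
  finally have "sqrt (6 / \<rho>Z) * (\<rho>Z * sqrt ((p + pZ) / (6 * \<rho>Z))) = sqrt (p + pZ)" .
  moreover have "0 < sqrt (p + pZ)" "0 < \<rho>Z * sqrt ((p + pZ) / (6 * \<rho>Z))" using assms by auto
  ultimately show ?thesis using assms unfolding wave_fun_def
    by (simp add: frac_eq_eq mult.commute mult.left_commute mult.assoc)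
qed

lemma wave_fun_below:
  assumes "p \<le> pZ"
  shows "wave_fun \<rho>Z pZ p = sqrt (12 / \<rho>Z) * (sqrt p - sqrt pZ)"
  using assms by (auto simp: wave_fun_def)

lemma wave_fun_strict_mono:
  assumes "0 < \<rho>Z" "0 < pZ" "0 \<le> p" "p < q"
  shows "wave_fun \<rho>Z pZ p < wave_fun \<rho>Z pZ q"
proof -
  have above: "(x - pZ) / sqrt (x + pZ) < (y - pZ) / sqrt (y + pZ)" if "pZ \<le> x" "x < y" for x y
  proof -
    \<comment> \<open>A difference of an increasing and a decreasing function of \<open>x\<close>.\<close>
    have *: "(x - pZ) / sqrt (x + pZ) = sqrt (x + pZ) - 2 * pZ / sqrt (x + pZ)" if "pZ \<le> x" for x
    proof -
      have "(x - pZ) / sqrt (x + pZ) = (x + pZ) / sqrt (x + pZ) - 2 * pZ / sqrt (x + pZ)"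
        by (simp add: diff_divide_distrib[symmetric])
      then show ?thesis using that assms by (simp add: real_div_sqrt)
    qed
    have "2 * pZ / sqrt (y + pZ) \<le> 2 * pZ / sqrt (x + pZ)"
      using that assms by (intro divide_left_mono) auto
    moreover have "sqrt (x + pZ) < sqrt (y + pZ)" using that by simp
    ultimately have "sqrt (x + pZ) - 2 * pZ / sqrt (x + pZ) < sqrt (y + pZ) - 2 * pZ / sqrt (y + pZ)"
      by linarith
    then show ?thesis using that by (simp add: *)
  qed
  have pos: "0 < sqrt (6 / \<rho>Z)" "0 < sqrt (12 / \<rho>Z)" using assms by auto
  consider "pZ \<le> p" | "q \<le> pZ" | "p < pZ" "pZ < q" by linarith
  then show ?thesis
  proof cases
    case 1
    then have "sqrt (6 / \<rho>Z) * ((p - pZ) / sqrt (p + pZ)) < sqrt (6 / \<rho>Z) * ((q - pZ) / sqrt (q + pZ))"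
      using above[of p q] assms pos by (intro mult_strict_left_mono) auto
    then show ?thesis using 1 assms by (simp add: wave_fun_def)
  next
    case 2
    then show ?thesis using assms pos by (simp add: wave_fun_below)
  next
    case 3
    then have "wave_fun \<rho>Z pZ p < 0" using pos by (simp add: wave_fun_below mult_pos_neg)
    moreover have "0 < wave_fun \<rho>Z pZ q" 
      using 3 assms pos by (auto simp: wave_fun_def intro!: divide_pos_pos mult_pos_pos)
    ultimately show ?thesis by linarith
  qed
qed

text \<open>If \<open>p = 0\<close>, the sign condition covers both the vacuum case of \<open>pstar\<close> and the case in
  which \<open>0\<close> itself is the root of \<open>phi\<close>.\<close>

lemma pstar_eqI:
  assumes pos: "0 < \<rho>L" "0 < pL" "0 < \<rho>R" "0 < pR" and p: "0 \<le> p"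
    and root: "0 < p \<Longrightarrow> phi \<rho>L vL pL \<rho>R vR pR p = 0"
    and vac: "p = 0 \<Longrightarrow> 0 \<le> phi \<rho>L vL pL \<rho>R vR pR 0"
  shows "pstar \<rho>L vL pL \<rho>R vR pR = p"
proof -
  let ?\<phi> = "phi \<rho>L vL pL \<rho>R vR pR"
  have mono: "?\<phi> x < ?\<phi> y" if "0 \<le> x" "x < y" for x y
    using wave_fun_strict_mono[OF pos(1,2) that] wave_fun_strict_mono[OF pos(3,4) that]
    by (simp add: phi_def)
  show ?thesis
  proof (cases "0 < ?\<phi> 0")
    case True
    then have "p = 0" using mono[of 0 p] p root by fastforce
    then show ?thesis using True by (simp add: pstar_def)
  next
    case False
    then have "?\<phi> p = 0" using p root vac by fastforce
    then have "(THE q. 0 \<le> q \<and> ?\<phi> q = 0) = p"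
      using p mono by (intro the_equality) (auto, metis less_irrefl linorder_neqE_linordered_idom)
    then show ?thesis using False by (simp add: pstar_def)
  qed
qed

section \<open>Shocks and fans\<close>

text \<open>Both relations are invariant under exchanging the sign of \<open>s\<close> and of the velocities, so they
  serve left and right shocks alike.\<close>

lemma shock_relations:
  assumes "0 < density O'" "density I = density O'" "0 < rad_pressure O'" "rad_pressure O' < rad_pressure I"
    and jump: "flux I - flux O' = s *\<^sub>R (conserved I - conserved O')"
  shows "s * (density O' * (velocity I - velocity O')) = rad_pressure I - rad_pressure O'"
    and "\<bar>s\<bar> = sqrt ((rad_pressure I + rad_pressure O') / (6 * density O'))"
proof -
  obtain \<rho> v E where O': "O' = (\<rho>, v, E)" by (cases O') auto
  obtain v' E' where I: "I = (\<rho>, v', E')" using assms O' by (cases I) auto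
  define p p' where "p = rad_pressure O'" and "p' = rad_pressure I"
  have E: "E = 3 * p + \<rho> * v\<^sup>2 / 2" "E' = 3 * p' + \<rho> * v'\<^sup>2 / 2"
    by (simp_all add: p_def p'_def O' I field_simps)
  have "p' - p = s * (\<rho> * v' - \<rho> * v)" and en: "v' * p' - v * p = s * (E' - E)"
    using jump unfolding p_def p'_def O' I by auto
  then have mom: "p' - p = s * \<rho> * (v' - v)" by (simp add: algebra_simps)
  then show "s * (density O' * (velocity I - velocity O')) = rad_pressure I - rad_pressure O'"
    unfolding p_def[symmetric] p'_def[symmetric] by (simp add: O' I)
  have "s * (E' - E) = 3 * s * (p' - p) + (s * \<rho> * (v' - v)) * (v' + v) / 2"
    unfolding E by (simp add: field_simps power2_eq_square)
  then have "v' * p' - v * p = 3 * s * (p' - p) + (p' - p) * (v' + v) / 2"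
    using en mom by simp
  then have "6 * s * (p' - p) = (v' - v) * (p' + p)"
    by (simp add: field_simps)
  then have "6 * s\<^sup>2 * \<rho> * (p' - p) = (s * \<rho> * (v' - v)) * (p' + p)"
    by (simp add: power2_eq_square)
  then have "6 * s\<^sup>2 * \<rho> * (p' - p) = (p' + p) * (p' - p)" using mom by (simp add: mult.commute)
  moreover have "p' - p \<noteq> 0" "0 < \<rho>" using assms by (auto simp: p_def p'_def O')
  ultimately have "6 * s\<^sup>2 * \<rho> = p' + p" "0 < \<rho>"
    using mult_right_cancel[of "p' - p"] by blast+
  then have "s\<^sup>2 = (p' + p) / (6 * \<rho>)" by (simp add: field_simps)
  then show "\<bar>s\<bar> = sqrt ((rad_pressure I + rad_pressure O') / (6 * density O'))"
    unfolding p_def[symmetric] p'_def[symmetric] by (simp add: O' flip: real_sqrt_abs)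
qed

text \<open>Fans may contain constant pieces, since at each point the equations allow either
  \<open>v' = 0\<close> or the sonic relation \<open>p = 3 \<rho> \<xi>\<^sup>2\<close>. The proof follows the sign of
  \<open>q = p - 3 \<rho> \<xi>\<^sup>2\<close>: everywhere \<open>p'\<close> is \<open>0\<close> or \<open>6 \<rho> \<xi>\<close>, so \<open>p\<close> is
  non-increasing and \<open>q\<close> is non-decreasing.\<close>

lemma fan_profile:
  fixes p v :: "real \<Rightarrow> real"
  assumes ab: "a \<le> b" "b \<le> 0" and \<rho>: "0 < \<rho>"
    and p_cont: "continuous_on {a..b} p" and v_cont: "continuous_on {a..b} v"
    and ode_all: "\<forall>\<xi>\<in>{a<..<b}. \<exists>p' v'. (p has_real_derivative p') (at \<xi>) \<and>
        (v has_real_derivative v') (at \<xi>) \<and> p' = \<xi> * \<rho> * v' \<and> v' * (p \<xi> - 3 * \<rho> * \<xi>\<^sup>2) = 0"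
    and pa: "0 < p a" and pb: "0 \<le> p b"
  shows "p b \<le> p a"
    and "v b = v a - sqrt (12 / \<rho>) * (sqrt (p b) - sqrt (p a))"
    and "\<And>\<xi>. \<lbrakk>a \<le> \<xi>; \<xi> \<le> b; \<xi> < - sqrt (p a / (3 * \<rho>))\<rbrakk> \<Longrightarrow> p \<xi> = p a \<and> v \<xi> = v a"
proof -
  have ode: "\<exists>p' v'. (p has_real_derivative p') (at \<xi>) \<and>
        (v has_real_derivative v') (at \<xi>) \<and> p' = \<xi> * \<rho> * v' \<and> v' * (p \<xi> - 3 * \<rho> * \<xi>\<^sup>2) = 0" if "a < \<xi>" "\<xi> < b" for \<xi>
    by (rule bspec[OF ode_all]) (simp add: that)
  define q where "q \<xi> = p \<xi> - 3 * \<rho> * \<xi>\<^sup>2" for \<xi>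
  have q_cont: "continuous_on {a..b} q"
    unfolding q_def[abs_def] by (intro continuous_intros p_cont)
  have sub: "{x..y} \<subseteq> {a..b}" if "a \<le> x" "y \<le> b" for x y using that by auto
  have off: "(p has_real_derivative 0) (at \<xi>)" "(v has_real_derivative 0) (at \<xi>)"
    if "a < \<xi>" "\<xi> < b" "q \<xi> \<noteq> 0" for \<xi>
    using ode[OF that(1,2)] that(3) unfolding q_def by auto
  have q_deriv: "(q has_real_derivative p' - 6 * \<rho> * \<xi>) (at \<xi>)"
    if "(p has_real_derivative p') (at \<xi>)" for p' \<xi>
    unfolding q_def[abs_def] using that by (auto intro!: derivative_eq_intros)
  have slope: "p' = 0 \<or> p' = 6 * \<rho> * \<xi>"
    if \<xi>: "a < \<xi>" "\<xi> < b" and p': "(p has_real_derivative p') (at \<xi>)" for \<xi> p'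
  proof (rule ccontr)
    assume neg: "\<not> ?thesis"
    then have "q \<xi> = 0" using off(1)[OF \<xi>] DERIV_unique[OF p'] by blast
    \<comment> \<open>If \<open>q' \<noteq> 0\<close> at a zero of \<open>q\<close>, then the zero is isolated, so \<open>p\<close> is constant next to
      it, which forces \<open>p' = 0\<close>.\<close>
    from q_deriv[OF p'] have "((\<lambda>y. (q y - q \<xi>) / (y - \<xi>)) \<longlongrightarrow> p' - 6 * \<rho> * \<xi>) (at \<xi>)"
      by (simp add: has_field_derivative_iff)
    from tendsto_imp_eventually_ne[OF this, of 0] neg \<open>q \<xi> = 0\<close>
    have "\<forall>\<^sub>F y in at \<xi>. q y \<noteq> 0" by (auto elim!: eventually_mono)
    then have "\<forall>\<^sub>F y in at_right \<xi>. q y \<noteq> 0" by (simp add: eventually_at_split)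
    then obtain c where c: "\<xi> < c" "\<And>y. \<xi> < y \<Longrightarrow> y < c \<Longrightarrow> q y \<noteq> 0"
      unfolding eventually_at_right_field by auto
    have flat: "p y = p \<xi>" if "\<xi> < y" "y < min c b" for y
    proof (rule DERIV_isconst_end[where f = p and a = \<xi> and b = y])
      show "continuous_on {\<xi>..y} p" by (rule continuous_on_subset[OF p_cont]) (use \<xi> that in auto)
      show "(p has_real_derivative 0) (at x)" if "\<xi> < x" "x < y" for x
        using that \<open>y < min c b\<close> \<xi> c(2) by (intro off) auto
    qed (use that in auto)
    have "((\<lambda>y. (p y - p \<xi>) / (y - \<xi>)) \<longlongrightarrow> p') (at_right \<xi>)"
      using p' by (auto simp: has_field_derivative_iff filterlim_at_split)
    moreover have "\<forall>\<^sub>F y in at_right \<xi>. (p y - p \<xi>) / (y - \<xi>) = 0"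
      unfolding eventually_at_right_field
      by (rule exI[of _ "min c b"]) (use \<xi> c flat in auto)
    then have "((\<lambda>y. (p y - p \<xi>) / (y - \<xi>)) \<longlongrightarrow> 0) (at_right \<xi>)" by (rule tendsto_eventually)
    ultimately have "p' = 0" using tendsto_unique by (metis trivial_limit_at_right_real)
    then show False using neg by simp
  qed
  have p_mono: "p y \<le> p x" if "a \<le> x" "x \<le> y" "y \<le> b" for x y
  proof (cases "x = y")
    case False
    show ?thesis
    proof (rule DERIV_nonpos_imp_decreasing_open[where f = p and a = x and b = y])
      show "\<exists>d. (p has_real_derivative d) (at \<xi>) \<and> d \<le> 0" if \<xi>: "x < \<xi>" "\<xi> < y" for \<xi>
      proof -
        have *: "a < \<xi>" "\<xi> < b" "\<xi> < 0" using \<xi> that \<open>a \<le> x\<close> \<open>y \<le> b\<close> ab by auto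
        obtain d where "(p has_real_derivative d) (at \<xi>)" using ode[OF *(1,2)] by blast
        moreover from slope[OF *(1,2) this] have "d \<le> 0" using * \<rho> by (auto simp: mult_pos_neg less_imp_le)
        ultimately show ?thesis by blast
      qed
    qed (use that continuous_on_subset[OF p_cont sub] in auto)
  qed simp
  have q_mono: "q x \<le> q y" if "a \<le> x" "x \<le> y" "y \<le> b" for x y
  proof (cases "x = y")
    case False
    show ?thesis
    proof (rule DERIV_nonneg_imp_increasing_open[where f = q and a = x and b = y])
      show "\<exists>d. (q has_real_derivative d) (at \<xi>) \<and> 0 \<le> d" if \<xi>: "x < \<xi>" "\<xi> < y" for \<xi>
      proof -
        have *: "a < \<xi>" "\<xi> < b" "\<xi> < 0" using \<xi> that \<open>a \<le> x\<close> \<open>y \<le> b\<close> ab by auto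
        obtain d where d: "(p has_real_derivative d) (at \<xi>)" using ode[OF *(1,2)] by blast
        moreover from slope[OF *(1,2) this] have "0 \<le> d - 6 * \<rho> * \<xi>"
          using * \<rho> by (auto simp: mult_pos_neg less_imp_le)
        ultimately show ?thesis using q_deriv by blast
      qed
    qed (use that continuous_on_subset[OF q_cont sub] in auto)
  qed simp
  have const: "p \<xi> = p a \<and> v \<xi> = v a"
    if "a \<le> \<xi>" "\<xi> \<le> b" and "\<And>y. a < y \<Longrightarrow> y < \<xi> \<Longrightarrow> q y \<noteq> 0" for \<xi>
  proof (cases "a = \<xi>")
    case False
    have "p \<xi> = p a"
      by (rule DERIV_isconst_end) (use False that off in \<open>auto intro: continuous_on_subset[OF p_cont]\<close>)
    moreover have "v \<xi> = v a"
      by (rule DERIV_isconst_end) (use False that off in \<open>auto intro: continuous_on_subset[OF v_cont]\<close>)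
    ultimately show ?thesis by simp
  qed simp
  \<comment> \<open>A zero of \<open>p\<close> before \<open>b\<close> would give \<open>q < 0\<close> on the whole way from \<open>a\<close>, hence
    \<open>p\<close> constant.\<close>
  have p_pos: "0 < p \<xi>" if "a \<le> \<xi>" "\<xi> < b" for \<xi>
  proof (rule ccontr)
    assume "\<not> 0 < p \<xi>"
    then have "p \<xi> = 0" using p_mono[of \<xi> b] pb that by simp
    then have "q \<xi> < 0" using that ab \<rho> by (simp add: q_def)
    then have "p \<xi> = p a"
      using const[of \<xi>] q_mono[of _ \<xi>] that by (metis less_eq_real_def not_less)
    then show False using pa \<open>p \<xi> = 0\<close> by simp
  qed
  show "p b \<le> p a" using p_mono ab by simp
  show "p \<xi> = p a \<and> v \<xi> = v a" if \<xi>: "a \<le> \<xi>" "\<xi> \<le> b" "\<xi> < - sqrt (p a / (3 * \<rho>))" for \<xi>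
  proof (rule const[OF \<xi>(1,2)])
    fix y assume y: "a < y" "y < \<xi>"
    have "sqrt (p a / (3 * \<rho>)) < - y" using y \<xi> by simp
    then have "(sqrt (p a / (3 * \<rho>)))\<^sup>2 < (- y)\<^sup>2"
      using pa \<rho> by (intro power_strict_mono) auto
    then have "p a < 3 * \<rho> * y\<^sup>2" using pa \<rho> by (simp add: field_simps)
    moreover have "p y \<le> p a" using p_mono y \<xi> by simp
    ultimately show "q y \<noteq> 0" by (simp add: q_def)
  qed
  show "v b = v a - sqrt (12 / \<rho>) * (sqrt (p b) - sqrt (p a))"
  proof (cases "a = b")
    case False
    have "v b + sqrt (12 / \<rho>) * sqrt (p b) = v a + sqrt (12 / \<rho>) * sqrt (p a)"
    proof (rule DERIV_isconst_end[where f = "\<lambda>\<xi>. v \<xi> + sqrt (12 / \<rho>) * sqrt (p \<xi>)"])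
      show "a < b" using False ab by simp
      show "continuous_on {a..b} (\<lambda>\<xi>. v \<xi> + sqrt (12 / \<rho>) * sqrt (p \<xi>))"
        by (intro continuous_intros p_cont v_cont)
      fix \<xi> assume \<xi>: "a < \<xi>" "\<xi> < b"
      then obtain p' v' where d: "(p has_real_derivative p') (at \<xi>)" "(v has_real_derivative v') (at \<xi>)"
        and e: "p' = \<xi> * \<rho> * v'" "v' * (p \<xi> - 3 * \<rho> * \<xi>\<^sup>2) = 0"
        using ode by blast
      have "v' + sqrt (12 / \<rho>) * (p' * (inverse (sqrt (p \<xi>)) / 2)) = 0"
      proof (cases "v' = 0")
        case False
        then have "p \<xi> = (3 * \<rho>) * \<xi>\<^sup>2" using e by simp
        then have sp: "sqrt (p \<xi>) = - (sqrt (3 * \<rho>) * \<xi>)"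
          using \<xi> ab by (simp add: real_sqrt_mult)
        have "sqrt (12 / \<rho>) = sqrt (2\<^sup>2 * (3 * \<rho>) / \<rho>\<^sup>2)"
          using \<rho> by (intro arg_cong[where f = sqrt]) (simp add: power2_eq_square)
        also have "\<dots> = 2 * sqrt (3 * \<rho>) / \<rho>"
          using \<rho> by (simp only: real_sqrt_mult real_sqrt_divide real_sqrt_abs)
        finally show ?thesis
          using \<rho> \<xi> ab unfolding sp e(1) by (simp add: field_simps)
      qed (simp add: e)
      then show "((\<lambda>\<xi>. v \<xi> + sqrt (12 / \<rho>) * sqrt (p \<xi>)) has_real_derivative 0) (at \<xi>)"
        using DERIV_add[OF d(2) DERIV_cmult[OF DERIV_chain2[OF DERIV_real_sqrt[OF p_pos] d(1)], of "sqrt (12 / \<rho>)"]] \<xi>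
        by (simp add: algebra_simps)
    qed
    then show ?thesis by (simp add: algebra_simps)
  qed simp
qed

section \<open>Riemann profiles\<close>

lemma primitive_eqs:
  "density s = fst s" "velocity s = fst (snd s)"
  "rad_pressure s = (snd (snd s) - fst s * (fst (snd s))\<^sup>2 / 2) / 3"
  "conserved s = (fst s, fst s * fst (snd s), snd (snd s))"
  "flux s = (0, rad_pressure s, fst (snd s) * rad_pressure s)"
  by (cases s; simp add: field_simps)+

lemma state_eqI:
  assumes "density s = density s'" "velocity s = velocity s'" "rad_pressure s = rad_pressure s'"
  shows "s = s'"
  using assms by (cases s; cases s') auto

lemma continuous_state_maps:
  "continuous_on A density" "continuous_on A velocity" "continuous_on A rad_pressure"
  "continuous_on A conserved" "continuous_on A flux"
  unfolding primitive_eqs[abs_def] by (intro continuous_intros; simp)+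

lemma isCont_state_maps: "isCont conserved s" "isCont flux s"
  using continuous_state_maps(4,5)[of UNIV]
  by (simp_all add: continuous_on_eq_continuous_at del: split_paired_All)

lemma weak_profile_of_solution:
  assumes sol: "weak_solution U (riemann_data UL UR)"
    and U: "\<forall>x t. 0 < t \<longrightarrow> U x t = W (x / t)"
    and meas: "W \<in> borel_measurable borel" and bdd: "bounded (range W)"
  shows "\<exists>B. weak_profile (\<lambda>s. conserved (W s)) (\<lambda>s. flux (W s)) B"
proof -
  have cpt: "compact (closure (range W))" using bdd by (simp add: compact_closure)
  have img: "bounded (f ` range W)" if "continuous_on (closure (range W)) f" for f :: "state \<Rightarrow> real \<times> real \<times> real"
    using compact_imp_bounded[OF compact_continuous_image[OF that cpt]]
    by (rule bounded_subset) (intro image_mono closure_subset)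
  obtain B1 where B1: "\<And>s. norm (conserved (W s)) \<le> B1"
    using img[OF continuous_state_maps(4)] unfolding bounded_iff by blast
  obtain B2 where B2: "\<And>s. norm (flux (W s)) \<le> B2"
    using img[OF continuous_state_maps(5)] unfolding bounded_iff by blast
  let ?B = "max B1 B2"
  have m: "(\<lambda>s. conserved (W s)) \<in> borel_measurable borel" "(\<lambda>s. flux (W s)) \<in> borel_measurable borel"
    by (intro measurable_compose[OF meas] borel_measurable_continuous_onI continuous_state_maps)+
  have b: "norm (conserved (W s)) \<le> ?B" "norm (flux (W s)) \<le> ?B" for s
    using B1[of s] B2[of s] by auto
  have weak: "(LINT z:{z. 0 < snd z}|lborel.
      \<psi>t z *\<^sub>R conserved (W (fst z / snd z)) + \<psi>x z *\<^sub>R flux (W (fst z / snd z))) = 0"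
    if "test_function \<psi> \<psi>x \<psi>t" "\<And>x. \<psi> (x, 0) = 0" for \<psi> \<psi>x \<psi>t
  proof -
    have "(LINT z:{z. 0 < snd z}|lborel.
          \<psi>t z *\<^sub>R conserved (U (fst z) (snd z)) + \<psi>x z *\<^sub>R flux (U (fst z) (snd z))) = 0"
      using sol[unfolded weak_solution_def, THEN conjunct2, THEN conjunct2, rule_format, OF that(1)]
      by (simp add: that(2))
    moreover have "(LINT z:{z. 0 < snd z}|lborel.
          \<psi>t z *\<^sub>R conserved (U (fst z) (snd z)) + \<psi>x z *\<^sub>R flux (U (fst z) (snd z))) =
        (LINT z:{z. 0 < snd z}|lborel.
          \<psi>t z *\<^sub>R conserved (W (fst z / snd z)) + \<psi>x z *\<^sub>R flux (W (fst z / snd z)))"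
      unfolding set_lebesgue_integral_def
      by (rule Bochner_Integration.integral_cong) (auto simp: indicator_def U)
    ultimately show ?thesis by simp
  qed
  have "weak_profile (\<lambda>s. conserved (W s)) (\<lambda>s. flux (W s)) ?B"
  proof (unfold_locales, goal_cases)
    case (5 \<eta> \<eta>' M)
    show ?case by (rule selfsimilar_weak_form[OF m b weak 5])
  qed (rule m b)+
  then show ?thesis by blast
qed

text \<open>A profile of states whose conserved variables and flux satisfy the weak form, continuous
  off a finite set \<open>S\<close>.\<close>

locale state_profile = weak_profile "\<lambda>s. conserved (W s)" "\<lambda>s. flux (W s)" B
  for W :: "real \<Rightarrow> state" and B +
  fixes S :: "real set"
  assumes finite_S: "finite S" and W_cont: "s \<notin> S \<Longrightarrow> isCont W s"
begin

lemma rankine_hugoniot: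
  assumes l: "(W \<longlongrightarrow> wl) (at_left s)" and r: "(W \<longlongrightarrow> wr) (at_right s)"
  shows "flux wr - flux wl = s *\<^sub>R (conserved wr - conserved wl)"
proof (rule jump_condition)
  have "open (- (S - {s}))" using finite_S by (intro open_Compl finite_imp_closed) simp
  then have "\<forall>\<^sub>F \<alpha> in at s. \<alpha> \<in> - (S - {s})" by (rule eventually_at_in_open') simp
  then have "\<forall>\<^sub>F \<alpha> in at_left s. \<alpha> \<in> - (S - {s})" by (simp add: eventually_at_split)
  moreover have "\<forall>\<^sub>F \<alpha> in at_left s. \<alpha> \<noteq> s" by (simp add: eventually_at_filter)
  ultimately show "\<forall>\<^sub>F \<alpha> in at_left s. isCont (\<lambda>s. conserved (W s)) \<alpha> \<and> isCont (\<lambda>s. flux (W s)) \<alpha>"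
  proof eventually_elim
    case (elim \<alpha>)
    then have "isCont W \<alpha>" using W_cont by blast
    then show ?case using isCont_o2[OF _ isCont_state_maps(1)] isCont_o2[OF _ isCont_state_maps(2)] by blast
  qed
qed (intro isCont_tendsto_compose[OF isCont_state_maps(1)] isCont_tendsto_compose[OF isCont_state_maps(2)] l r)+

text \<open>The fan equation in primitive variables. The first component gives \<open>\<xi> \<rho>' = 0\<close>, so the
  density is constant on a fan that does not contain \<open>0\<close> in its interior.\<close>

lemma rarefaction_ode:
  assumes R_cont: "continuous_on {a..b} R" and R_diff: "\<forall>\<xi>\<in>{a<..<b}. R differentiable (at \<xi>)"
    and WR: "\<forall>\<xi>\<in>{a<..<b}. W \<xi> = R \<xi>" and away: "b \<le> 0 \<or> 0 \<le> a"
  shows "\<xi> \<in> {a..b} \<Longrightarrow> density (R \<xi>) = density (R a)"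
    and "\<forall>\<xi>\<in>{a<..<b}. \<exists>p' v'. ((\<lambda>s. rad_pressure (R s)) has_real_derivative p') (at \<xi>) \<and>
      ((\<lambda>s. velocity (R s)) has_real_derivative v') (at \<xi>) \<and> p' = \<xi> * density (R a) * v' \<and>
      v' * (rad_pressure (R \<xi>) - 3 * density (R a) * \<xi>\<^sup>2) = 0"
proof -
  have W: "W \<xi> = R \<xi>" if "\<xi> \<in> {a<..<b}" for \<xi> using WR that by blast
  define r v e where "r \<xi> = fst (R \<xi>)" and "v \<xi> = fst (snd (R \<xi>))" and "e \<xi> = snd (snd (R \<xi>))" for \<xi>
  define p where "p \<xi> = rad_pressure (R \<xi>)" for \<xi>
  have p: "p \<xi> = (e \<xi> - r \<xi> * (v \<xi>)\<^sup>2 / 2) / 3" for \<xi>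
    by (simp add: p_def r_def v_def e_def primitive_eqs)
  have u_cont: "continuous_on {a<..<b} (\<lambda>s. conserved (W s))"
   and F_cont: "continuous_on {a<..<b} (\<lambda>s. flux (W s))"
  proof -
    have "continuous_on {a<..<b} R" by (rule continuous_on_subset[OF R_cont]) auto
    then have "continuous_on {a<..<b} W" using W by (subst continuous_on_cong[OF refl]) auto
    then show "continuous_on {a<..<b} (\<lambda>s. conserved (W s))" "continuous_on {a<..<b} (\<lambda>s. flux (W s))"
      using continuous_on_compose2[OF continuous_state_maps(4)[of UNIV]]
        continuous_on_compose2[OF continuous_state_maps(5)[of UNIV]] by blast+
  qed
  have ex: "\<exists>r' v' e'. (r has_real_derivative r') (at \<xi>) \<and> (v has_real_derivative v') (at \<xi>) \<and>
      (e has_real_derivative e') (at \<xi>)" if "\<xi> \<in> {a<..<b}" for \<xi>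
  proof -
    have "R differentiable (at \<xi>)" using R_diff that by blast
    then obtain R' where R': "(R has_derivative R') (at \<xi>)" by (auto simp: differentiable_def)
    have "r differentiable (at \<xi>)" "v differentiable (at \<xi>)" "e differentiable (at \<xi>)"
      unfolding r_def[abs_def] v_def[abs_def] e_def[abs_def] differentiable_def
      using has_derivative_fst[OF R'] has_derivative_fst[OF has_derivative_snd[OF R']]
        has_derivative_snd[OF has_derivative_snd[OF R']] by blast+
    then show ?thesis by (meson real_differentiable_def)
  qed
  have eqs: "\<xi> * r' = 0" "p' = \<xi> * (r' * v \<xi> + r \<xi> * v')" "v' * p \<xi> + v \<xi> * p' = \<xi> * e'"
    if \<xi>: "\<xi> \<in> {a<..<b}" and d: "(r has_real_derivative r') (at \<xi>)" "(v has_real_derivative v') (at \<xi>)"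
      "(e has_real_derivative e') (at \<xi>)" "(p has_real_derivative p') (at \<xi>)" for \<xi> r' v' e' p'
  proof -
    define G' where "G' s = (- s * r s, p s - s * (r s * v s), v s * p s - s * e s)" for s
    have der: "(G has_vector_derivative - conserved (W \<xi>)) (at \<xi>)"
      by (rule fan_equation[OF u_cont F_cont \<xi>])
    have eq: "G y = G' y" if "y \<in> {a<..<b}" for y
    proof -
      have "G y = flux (R y) - y *\<^sub>R conserved (R y)" 
        by (simp only: G_def W[OF that])
      also have "\<dots> = G' y" by (simp add: G'_def primitive_eqs(4,5) r_def v_def e_def p_def)
      finally show ?thesis .
    qed
    have G': "(G' has_vector_derivative - conserved (W \<xi>)) (at \<xi>)"
      by (rule has_vector_derivative_transform_within_open[OF der open_greaterThanLessThan \<xi>]) (rule eq)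
    have lin: "bounded_linear (\<lambda>x::real \<times> real \<times> real. fst x)" "bounded_linear (\<lambda>x::real \<times> real \<times> real. fst (snd x))"
      "bounded_linear (\<lambda>x::real \<times> real \<times> real. snd (snd x))"
      by (intro bounded_linear_fst bounded_linear_snd bounded_linear_fst_comp bounded_linear_snd_comp)+
    have "((\<lambda>s. - s * r s) has_real_derivative - r \<xi>) (at \<xi>)"
      "((\<lambda>s. p s - s * (r s * v s)) has_real_derivative - (r \<xi> * v \<xi>)) (at \<xi>)"
      "((\<lambda>s. v s * p s - s * e s) has_real_derivative - e \<xi>) (at \<xi>)"
      using bounded_linear.has_vector_derivative[OF lin(1) G'] bounded_linear.has_vector_derivative[OF lin(2) G']
        bounded_linear.has_vector_derivative[OF lin(3) G'] W[OF \<xi>]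
      by (simp_all add: has_real_derivative_iff_has_vector_derivative G'_def primitive_eqs(4) r_def v_def e_def)
    moreover have "((\<lambda>s. - s * r s) has_real_derivative - r \<xi> - \<xi> * r') (at \<xi>)"
      "((\<lambda>s. p s - s * (r s * v s)) has_real_derivative p' - (r \<xi> * v \<xi> + \<xi> * (r' * v \<xi> + r \<xi> * v'))) (at \<xi>)"
      "((\<lambda>s. v s * p s - s * e s) has_real_derivative v' * p \<xi> + v \<xi> * p' - (e \<xi> + \<xi> * e')) (at \<xi>)"
      using d by (auto intro!: derivative_eq_intros)
    ultimately have "- r \<xi> = - r \<xi> - \<xi> * r'" "- (r \<xi> * v \<xi>) = p' - (r \<xi> * v \<xi> + \<xi> * (r' * v \<xi> + r \<xi> * v'))"
      "- e \<xi> = v' * p \<xi> + v \<xi> * p' - (e \<xi> + \<xi> * e')"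
      by (blast intro: DERIV_unique)+
    then show "\<xi> * r' = 0" "p' = \<xi> * (r' * v \<xi> + r \<xi> * v')" "v' * p \<xi> + v \<xi> * p' = \<xi> * e'"
      by simp_all
  qed
  have p_deriv: "(p has_real_derivative (e' - (r' * (v \<xi>)\<^sup>2 + r \<xi> * (2 * v \<xi> * v')) / 2) / 3) (at \<xi>)"
    if "(r has_real_derivative r') (at \<xi>)" "(v has_real_derivative v') (at \<xi>)" "(e has_real_derivative e') (at \<xi>)"
    for \<xi> r' v' e'
    unfolding p[abs_def] using that by (auto intro!: derivative_eq_intros)
  have r0: "(r has_real_derivative 0) (at \<xi>)" if \<xi>: "\<xi> \<in> {a<..<b}" for \<xi>
  proof -
    obtain r' v' e' where d: "(r has_real_derivative r') (at \<xi>)" "(v has_real_derivative v') (at \<xi>)"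
      "(e has_real_derivative e') (at \<xi>)" using ex[OF \<xi>] by blast
    then have "\<xi> * r' = 0" using eqs(1)[OF \<xi> d p_deriv[OF d]] by simp
    then have "r' = 0" using \<xi> away by auto
    then show ?thesis using d by simp
  qed
  have r_const: "r \<xi> = r a" if "\<xi> \<in> {a..b}" for \<xi>
  proof (cases "\<xi> = a")
    case False
    have "continuous_on {a..b} r" unfolding r_def[abs_def] by (intro continuous_intros R_cont)
    then have "continuous_on {a..\<xi>} r" by (rule continuous_on_subset) (use that in auto)
    then show ?thesis using False that r0 by (intro DERIV_isconst_end[where f = r]) auto
  qed simp
  from r_const[of \<xi>] show "\<xi> \<in> {a..b} \<Longrightarrow> density (R \<xi>) = density (R a)"
    unfolding primitive_eqs(1) r_def .
  show "\<forall>\<xi>\<in>{a<..<b}. \<exists>p' v'. ((\<lambda>s. rad_pressure (R s)) has_real_derivative p') (at \<xi>) \<and>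
      ((\<lambda>s. velocity (R s)) has_real_derivative v') (at \<xi>) \<and> p' = \<xi> * density (R a) * v' \<and>
      v' * (rad_pressure (R \<xi>) - 3 * density (R a) * \<xi>\<^sup>2) = 0"
  proof
    fix \<xi> assume "\<xi> \<in> {a<..<b}"
    then have \<xi>: "a < \<xi>" "\<xi> < b" by auto
    then obtain v' e' where d: "(r has_real_derivative 0) (at \<xi>)" "(v has_real_derivative v') (at \<xi>)"
      "(e has_real_derivative e') (at \<xi>)" using ex[of \<xi>] r0[of \<xi>] by auto
    let ?p' = "(e' - (0 * (v \<xi>)\<^sup>2 + r \<xi> * (2 * v \<xi> * v')) / 2) / 3"
    note pd = p_deriv[OF d]
    have mom: "?p' = \<xi> * r \<xi> * v'" and en: "v' * p \<xi> + v \<xi> * ?p' = \<xi> * e'"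
      using eqs(2,3)[OF _ d pd] \<xi> by auto
    have "e' = 3 * (\<xi> * r \<xi> * v') + r \<xi> * v \<xi> * v'" using mom by simp
    with en mom have "v' * p \<xi> + v \<xi> * (\<xi> * r \<xi> * v') = \<xi> * (3 * (\<xi> * r \<xi> * v') + r \<xi> * v \<xi> * v')" by simp
    then have en': "v' * (p \<xi> - 3 * r \<xi> * \<xi>\<^sup>2) = 0" by (simp add: power2_eq_square algebra_simps)
    have r: "r \<xi> = density (R a)" using r_const[of \<xi>] \<xi> unfolding primitive_eqs(1) r_def by simp
    have fold: "(\<lambda>s. rad_pressure (R s)) = p" "(\<lambda>s. velocity (R s)) = v"
      by (simp_all add: fun_eq_iff p_def v_def primitive_eqs(2))
    show "\<exists>p' v'. ((\<lambda>s. rad_pressure (R s)) has_real_derivative p') (at \<xi>) \<and>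
        ((\<lambda>s. velocity (R s)) has_real_derivative v') (at \<xi>) \<and> p' = \<xi> * density (R a) * v' \<and>
        v' * (rad_pressure (R \<xi>) - 3 * density (R a) * \<xi>\<^sup>2) = 0"
      unfolding fold p_def[symmetric] r[symmetric]
      by (rule exI[of _ ?p'], rule exI[of _ v'], intro conjI)
        (rule pd d(2) mom en')+
  qed
qed

end

text \<open>The characteristic speed of the outer state never exceeds the bound for the wave.\<close>

lemma fan_wave_speed:
  assumes "0 < \<rho>"
  shows "sqrt ((p + max q p) / (6 * \<rho>)) \<ge> sqrt (p / (3 * \<rho>))"
  using assms by (intro real_sqrt_le_mono) (simp add: field_simps)

lemma tendsto_at_side_const:
  fixes W :: "real \<Rightarrow> state"
  shows "l < s \<Longrightarrow> (\<And>x. l < x \<Longrightarrow> x < s \<Longrightarrow> W x = k) \<Longrightarrow> (W \<longlongrightarrow> k) (at_left s)"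
    and "s < r \<Longrightarrow> (\<And>x. s < x \<Longrightarrow> x < r \<Longrightarrow> W x = k) \<Longrightarrow> (W \<longlongrightarrow> k) (at_right s)"
  by (rule tendsto_eventually, (unfold eventually_at_left_field eventually_at_right_field)[1], blast)+

context state_profile
begin

text \<open>The third conclusion is needed for the contact: if a fan reaches \<open>\<xi> = 0\<close>, the state \<open>M\<close>
  is attained only as a limit.\<close>

lemma left_wave:
  assumes ab: "a < 0" "a \<le> b" "b \<le> 0"
    and W_out_all: "\<forall>\<xi>. \<xi> < a \<longrightarrow> W \<xi> = Z" and W_in_all: "\<forall>\<xi>. b < \<xi> \<and> \<xi> < 0 \<longrightarrow> W \<xi> = M"
    and wave: "admissible_shock a b Z M \<or> rarefaction W a b Z M"
    and dens: "density M = density Z" "0 < density Z"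
    and pres: "0 < rad_pressure Z" "0 \<le> rad_pressure M"
  shows "velocity M = velocity Z - wave_fun (density Z) (rad_pressure Z) (rad_pressure M)"
    and "\<xi> < lambda_L_minus (density Z) (rad_pressure Z) (rad_pressure M) \<Longrightarrow> W \<xi> = Z"
    and "(W \<longlongrightarrow> M) (at_left 0)"
proof -
  let ?\<rho> = "density Z" and ?p = "rad_pressure Z" and ?q = "rad_pressure M"
  let ?sp = "sqrt ((?p + max ?q ?p) / (6 * ?\<rho>))"
  have W_out: "W \<xi> = Z" if "\<xi> < a" for \<xi> using W_out_all that by blast
  have W_in: "W \<xi> = M" if "b < \<xi>" "\<xi> < 0" for \<xi> using W_in_all that by blast
  have speed: "lambda_L_minus ?\<rho> ?p ?q = - ?sp" "0 < ?sp"
    using dens pres by (auto simp: lambda_L_minus_def)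
  have in_lim: "(W \<longlongrightarrow> M) (at_left 0)" if "b < 0"
    by (rule tendsto_at_side_const(1)[OF that W_in])
  have "velocity M = velocity Z - wave_fun ?\<rho> ?p ?q \<and> (\<forall>\<xi> < - ?sp. W \<xi> = Z) \<and> (W \<longlongrightarrow> M) (at_left 0)"
    using wave
  proof
    assume "admissible_shock a b Z M"
    then have shock: "b = a" "?p < ?q" by (auto simp: admissible_shock_def)
    have "flux M - flux Z = a *\<^sub>R (conserved M - conserved Z)"
    proof (rule rankine_hugoniot)
      show "(W \<longlongrightarrow> Z) (at_left a)" by (rule tendsto_at_side_const(1)[of "a - 1" a]) (use ab W_out in auto)
      show "(W \<longlongrightarrow> M) (at_right a)"
        by (rule tendsto_at_side_const(2)[of a 0]) (use ab W_in shock in auto)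
    qed
    note rel = shock_relations[OF dens(2) dens(1) pres(1) shock(2) this]
    have a: "a = - sqrt ((?q + ?p) / (6 * ?\<rho>))" using rel(2) ab by simp
    have "velocity M = velocity Z + (?q - ?p) / (a * ?\<rho>)"
      using rel(1) ab dens by (simp add: field_simps)
    then have "velocity M = velocity Z - wave_fun ?\<rho> ?p ?q"
      using wave_fun_above[of ?\<rho> ?p ?q] shock dens pres unfolding a by (simp add: mult.commute)
    moreover have "- ?sp = a" using shock by (simp add: a add.commute)
    ultimately show ?thesis using W_out in_lim shock ab by auto
  next
    assume "rarefaction W a b Z M"
    then obtain R where R: "continuous_on {a..b} R" "\<forall>\<xi>\<in>{a<..<b}. R differentiable (at \<xi>)"
      "R a = Z" "R b = M" "\<And>\<xi>. \<xi> \<in> {a..b} - {0} \<Longrightarrow> W \<xi> = R \<xi>"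
      unfolding rarefaction_def by blast
    have WR: "\<forall>\<xi>\<in>{a<..<b}. W \<xi> = R \<xi>" using ab R(5) by auto
    have b: "b \<le> 0 \<or> 0 \<le> a" using ab by simp
    note ode = rarefaction_ode[OF R(1,2) WR b, unfolded R(3)]
    have comp: "continuous_on {a..b} (\<lambda>s. rad_pressure (R s))" "continuous_on {a..b} (\<lambda>s. velocity (R s))"
      by (rule continuous_on_compose2[OF continuous_state_maps(3)[of UNIV] R(1)] continuous_on_compose2[OF continuous_state_maps(2)[of UNIV] R(1)]; simp)+
    have "0 < rad_pressure (R a)" "0 \<le> rad_pressure (R b)" using pres R by auto
    note fan = fan_profile[OF ab(2,3) dens(2) comp ode(2) this, unfolded R(3,4)]
    have still: "R \<xi> = Z" if "a \<le> \<xi>" "\<xi> \<le> b" "\<xi> < - ?sp" for \<xi>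
    proof (rule state_eqI)
      show "density (R \<xi>) = ?\<rho>" using ode(1)[of \<xi>] that by simp
      have "\<xi> < - sqrt (?p / (3 * ?\<rho>))" using that(3) fan_wave_speed[OF dens(2), of ?p ?q] by linarith
      from fan(3)[OF that(1,2) this]
      show "velocity (R \<xi>) = velocity Z" "rad_pressure (R \<xi>) = ?p" by auto
    qed
    have "W \<xi> = Z" if "\<xi> < - ?sp" for \<xi>
    proof -
      have "\<xi> < 0" using that speed(2) by linarith
      consider "\<xi> < a" | "a \<le> \<xi>" "\<xi> \<le> b" | "b < \<xi>" by linarith
      then show ?thesis
      proof cases
        case 2
        then show ?thesis using R(5)[of \<xi>] still[of \<xi>] that \<open>\<xi> < 0\<close> by auto
      next
        case 3
        then have "R b = Z" using still[of b] ab that by simp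
        then show ?thesis using 3 W_in[of \<xi>] \<open>\<xi> < 0\<close> R(4) by simp
      qed (rule W_out)
    qed
    moreover have "(W \<longlongrightarrow> M) (at_left 0)"
    proof (cases "b = 0")
      case True
      then have "(R \<longlongrightarrow> M) (at_left 0)"
        using R(1,4) ab(1) at_within_Icc_at_left[of a 0] unfolding continuous_on_def
        by (metis atLeastAtMost_iff order_refl less_imp_le)
      moreover have "\<forall>\<^sub>F \<xi> in at_left 0. R \<xi> = W \<xi>"
        unfolding eventually_at_left_field using ab(1) WR True by (intro exI[of _ a]) auto
      ultimately show ?thesis by (rule Lim_transform_eventually)
    qed (use in_lim ab in simp)
    ultimately show ?thesis using fan(1,2) by (simp add: wave_fun_below)
  qed
  then show "velocity M = velocity Z - wave_fun ?\<rho> ?p ?q" "(W \<longlongrightarrow> M) (at_left 0)"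
    and "\<xi> < lambda_L_minus ?\<rho> ?p ?q \<Longrightarrow> W \<xi> = Z"
    unfolding speed by blast+
qed

text \<open>The mirror image of \<open>left_wave\<close>: fans are reflected by \<open>\<xi> \<mapsto> - \<xi>\<close>, \<open>v \<mapsto> - v\<close>.\<close>

lemma right_wave:
  assumes cd: "0 \<le> c" "c \<le> d" "0 < d"
    and W_out_all: "\<forall>\<xi>. d < \<xi> \<longrightarrow> W \<xi> = Z" and W_in_all: "\<forall>\<xi>. 0 < \<xi> \<and> \<xi> < c \<longrightarrow> W \<xi> = M"
    and wave: "admissible_shock c d Z M \<or> rarefaction W c d M Z"
    and dens: "density M = density Z" "0 < density Z"
    and pres: "0 < rad_pressure Z" "0 \<le> rad_pressure M"
  shows "velocity M = velocity Z + wave_fun (density Z) (rad_pressure Z) (rad_pressure M)"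
    and "lambda_R_plus (density Z) (rad_pressure Z) (rad_pressure M) < \<xi> \<Longrightarrow> W \<xi> = Z"
    and "(W \<longlongrightarrow> M) (at_right 0)"
proof -
  let ?\<rho> = "density Z" and ?p = "rad_pressure Z" and ?q = "rad_pressure M"
  let ?sp = "sqrt ((?p + max ?q ?p) / (6 * ?\<rho>))"
  have W_out: "W \<xi> = Z" if "d < \<xi>" for \<xi> using W_out_all that by blast
  have W_in: "W \<xi> = M" if "0 < \<xi>" "\<xi> < c" for \<xi> using W_in_all that by blast
  have speed: "lambda_R_plus ?\<rho> ?p ?q = ?sp" "0 < ?sp"
    using dens pres by (auto simp: lambda_R_plus_def)
  have in_lim: "(W \<longlongrightarrow> M) (at_right 0)" if "0 < c"
    by (rule tendsto_at_side_const(2)[OF that W_in])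
  have "velocity M = velocity Z + wave_fun ?\<rho> ?p ?q \<and> (\<forall>\<xi> > ?sp. W \<xi> = Z) \<and> (W \<longlongrightarrow> M) (at_right 0)"
    using wave
  proof
    assume "admissible_shock c d Z M"
    then have shock: "c = d" "?p < ?q" by (auto simp: admissible_shock_def)
    have "flux Z - flux M = d *\<^sub>R (conserved Z - conserved M)"
    proof (rule rankine_hugoniot)
      show "(W \<longlongrightarrow> M) (at_left d)" by (rule tendsto_at_side_const(1)[of 0 d]) (use cd W_in shock in auto)
      show "(W \<longlongrightarrow> Z) (at_right d)"
        by (rule tendsto_at_side_const(2)[of d "d + 1"]) (use cd W_out in auto)
    qed
    then have "- (flux Z - flux M) = - (d *\<^sub>R (conserved Z - conserved M))" by simp
    then have "flux M - flux Z = d *\<^sub>R (conserved M - conserved Z)"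
      unfolding scaleR_minus_right[symmetric] minus_diff_eq .
    note rel = shock_relations[OF dens(2) dens(1) pres(1) shock(2) this]
    have d: "d = sqrt ((?q + ?p) / (6 * ?\<rho>))" using rel(2) cd by simp
    have "velocity M = velocity Z + (?q - ?p) / (d * ?\<rho>)"
      using rel(1) cd dens by (simp add: field_simps)
    then have "velocity M = velocity Z + wave_fun ?\<rho> ?p ?q"
      using wave_fun_above[of ?\<rho> ?p ?q] shock dens pres unfolding d by (simp add: mult.commute)
    moreover have "?sp = d" using shock by (simp add: d add.commute)
    ultimately show ?thesis using W_out in_lim shock cd by auto
  next
    assume "rarefaction W c d M Z"
    then obtain R where R: "continuous_on {c..d} R" "\<forall>\<xi>\<in>{c<..<d}. R differentiable (at \<xi>)"
      "R c = M" "R d = Z" "\<And>\<xi>. \<xi> \<in> {c..d} - {0} \<Longrightarrow> W \<xi> = R \<xi>"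
      unfolding rarefaction_def by blast
    have WR: "\<forall>\<xi>\<in>{c<..<d}. W \<xi> = R \<xi>" using cd R(5) by auto
    have c: "d \<le> 0 \<or> 0 \<le> c" using cd by simp
    note ode = rarefaction_ode[OF R(1,2) WR c, unfolded R(3) dens(1)]
    define p v where "p s = rad_pressure (R (- s))" and "v s = - velocity (R (- s))" for s
    have R': "continuous_on {- d..- c} (\<lambda>s. R (- s))"
      by (rule continuous_on_compose2[OF R(1)]) (auto intro!: continuous_intros)
    have comp: "continuous_on {- d..- c} p" "continuous_on {- d..- c} v"
      using continuous_on_compose2[OF continuous_state_maps(3)[of UNIV] R']
        continuous_on_minus[OF continuous_on_compose2[OF continuous_state_maps(2)[of UNIV] R']]
      by (simp_all add: p_def[abs_def] v_def[abs_def])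
    have ode': "\<forall>\<xi>\<in>{- d<..<- c}. \<exists>p' v'. (p has_real_derivative p') (at \<xi>) \<and> (v has_real_derivative v') (at \<xi>) \<and>
        p' = \<xi> * ?\<rho> * v' \<and> v' * (p \<xi> - 3 * ?\<rho> * \<xi>\<^sup>2) = 0"
    proof
      fix \<xi> assume \<xi>: "\<xi> \<in> {- d<..<- c}"
      then have "- \<xi> \<in> {c<..<d}" by auto
      from bspec[OF ode(2) this] obtain p' v' where d: "((\<lambda>s. rad_pressure (R s)) has_real_derivative p') (at (- \<xi>))"
        "((\<lambda>s. velocity (R s)) has_real_derivative v') (at (- \<xi>))"
        and e: "p' = - \<xi> * ?\<rho> * v'" "v' * (rad_pressure (R (- \<xi>)) - 3 * ?\<rho> * (- \<xi>)\<^sup>2) = 0"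
        by blast
      have m: "((\<lambda>s. - s) has_real_derivative - 1) (at \<xi>)" by (auto intro!: derivative_eq_intros)
      have "(p has_real_derivative - p') (at \<xi>)" "(v has_real_derivative v') (at \<xi>)"
        using DERIV_chain2[OF d(1) m] DERIV_minus[OF DERIV_chain2[OF d(2) m]]
        by (simp_all add: p_def[abs_def] v_def[abs_def])
      then show "\<exists>p' v'. (p has_real_derivative p') (at \<xi>) \<and> (v has_real_derivative v') (at \<xi>) \<and>
        p' = \<xi> * ?\<rho> * v' \<and> v' * (p \<xi> - 3 * ?\<rho> * \<xi>\<^sup>2) = 0"
        using e by (intro exI[of _ "- p'"] exI[of _ v']) (simp add: p_def)
    qed
    have pv: "p (- d) = ?p" "p (- c) = ?q" "v (- d) = - velocity Z" "v (- c) = - velocity M"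
      by (simp_all add: p_def v_def R)
    have "- d \<le> - c" "- c \<le> 0" "0 < p (- d)" "0 \<le> p (- c)" using cd pres pv by auto
    note fan = fan_profile[OF this(1,2) dens(2) comp ode' this(3,4), unfolded pv]
    have still: "R \<xi> = Z" if "c \<le> \<xi>" "\<xi> \<le> d" "?sp < \<xi>" for \<xi>
    proof (rule state_eqI)
      show "density (R \<xi>) = ?\<rho>" using ode(1)[of \<xi>] that by simp
      have "- \<xi> < - sqrt (?p / (3 * ?\<rho>))" using that(3) fan_wave_speed[OF dens(2), of ?p ?q] by linarith
      with fan(3)[of "- \<xi>"] that
      show "velocity (R \<xi>) = velocity Z" "rad_pressure (R \<xi>) = ?p" by (auto simp: p_def v_def)
    qed
    have "W \<xi> = Z" if "?sp < \<xi>" for \<xi>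
    proof -
      have "0 < \<xi>" using that speed(2) by linarith
      consider "d < \<xi>" | "c \<le> \<xi>" "\<xi> \<le> d" | "\<xi> < c" by linarith
      then show ?thesis
      proof cases
        case 2
        then show ?thesis using R(5)[of \<xi>] still[of \<xi>] that \<open>0 < \<xi>\<close> by auto
      next
        case 3
        then have "R c = Z" using still[of c] cd that by simp
        then show ?thesis using 3 W_in[of \<xi>] \<open>0 < \<xi>\<close> R(3) by simp
      qed (rule W_out)
    qed
    moreover have "(W \<longlongrightarrow> M) (at_right 0)"
    proof (cases "c = 0")
      case True
      then have "(R \<longlongrightarrow> M) (at_right 0)"
        using R(1,3) cd(3) at_within_Icc_at_right[of 0 d] unfolding continuous_on_def
        by (metis atLeastAtMost_iff order_refl less_imp_le)
      moreover have "\<forall>\<^sub>F \<xi> in at_right 0. R \<xi> = W \<xi>"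
        unfolding eventually_at_right_field using cd(3) WR True by (intro exI[of _ d]) auto
      ultimately show ?thesis by (rule Lim_transform_eventually)
    qed (use in_lim cd in simp)
    ultimately show ?thesis using fan(1,2) by (simp add: wave_fun_below)
  qed
  then show "velocity M = velocity Z + wave_fun ?\<rho> ?p ?q" "(W \<longlongrightarrow> M) (at_right 0)"
    and "lambda_R_plus ?\<rho> ?p ?q < \<xi> \<Longrightarrow> W \<xi> = Z"
    unfolding speed by blast+
qed

end

lemma wave_segment:
  assumes wave: "admissible_shock a b Z M \<or> rarefaction W a b S T" and away: "b \<le> 0 \<or> 0 \<le> a"
  shows "bounded (W ` {a..b})" and "\<xi> \<in> {a<..<b} \<Longrightarrow> isCont W \<xi>"
proof -
  have "bounded (W ` {a..b}) \<and> (\<forall>\<xi>\<in>{a<..<b}. isCont W \<xi>)"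
    using wave
  proof
    assume "rarefaction W a b S T"
    then obtain R where R: "continuous_on {a..b} R" "\<And>\<xi>. \<xi> \<in> {a..b} - {0} \<Longrightarrow> W \<xi> = R \<xi>"
      unfolding rarefaction_def by blast
    have "bounded (R ` {a..b})"
      by (intro compact_imp_bounded compact_continuous_image R(1) compact_Icc)
    moreover have "W ` {a..b} \<subseteq> insert (W 0) (R ` {a..b})" using R(2) by blast
    ultimately have "bounded (W ` {a..b})" by (meson bounded_insert bounded_subset)
    moreover have "continuous_on {a<..<b} R" by (rule continuous_on_subset[OF R(1)]) auto
    then have "continuous_on {a<..<b} W"
      using R(2) away by (subst continuous_on_cong[OF refl, of _ _ R]) auto
    ultimately show ?thesis by (auto simp: continuous_on_eq_continuous_at)
  qed (simp add: admissible_shock_def)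
  then show "bounded (W ` {a..b})" "\<xi> \<in> {a<..<b} \<Longrightarrow> isCont W \<xi>" by blast+
qed

lemma isCont_of_locally_const:
  fixes W :: "real \<Rightarrow> state"
  assumes "open A" "x \<in> A" "\<And>y. y \<in> A \<Longrightarrow> W y = k"
  shows "isCont W x"
proof -
  have "continuous_on A W" using assms(3) by (subst continuous_on_cong[OF refl, of _ _ "\<lambda>_. k"]) auto
  then show ?thesis using assms continuous_on_eq_continuous_at by blast
qed

lemma riemann_structure_regular:
  assumes ab: "a < 0" "a \<le> b" "b \<le> 0" and cd: "0 \<le> c" "c \<le> d" "0 < d"
    and out: "\<forall>\<xi>. \<xi> < a \<longrightarrow> W \<xi> = UL" "\<forall>\<xi>. d < \<xi> \<longrightarrow> W \<xi> = UR"
    and inn: "\<forall>\<xi>. b < \<xi> \<and> \<xi> < 0 \<longrightarrow> W \<xi> = Ml" "\<forall>\<xi>. 0 < \<xi> \<and> \<xi> < c \<longrightarrow> W \<xi> = Mr"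
    and waves: "admissible_shock a b UL Ml \<or> rarefaction W a b UL Ml"
      "admissible_shock c d UR Mr \<or> rarefaction W c d Mr UR"
  shows "\<xi> \<notin> {a, b, 0, c, d} \<Longrightarrow> isCont W \<xi>" and "bounded (range W)"
    and "W \<in> borel_measurable borel"
proof -
  have "b \<le> 0 \<or> 0 \<le> a" "d \<le> 0 \<or> 0 \<le> c" using ab cd by auto
  note seg = wave_segment[OF waves(1) this(1)] wave_segment[OF waves(2) this(2)]
  have cont: "isCont W \<xi>" if "\<xi> \<notin> {a, b, 0, c, d}" for \<xi>
  proof -
    have "\<xi> \<noteq> a" "\<xi> \<noteq> b" "\<xi> \<noteq> 0" "\<xi> \<noteq> c" "\<xi> \<noteq> d" using that by auto
    then consider "\<xi> < a" | "a < \<xi>" "\<xi> < b" | "b < \<xi>" "\<xi> < 0" | "0 < \<xi>" "\<xi> < c" | "c < \<xi>" "\<xi> < d" | "d < \<xi>"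
      by linarith
    then show ?thesis
    proof cases
      case 1
      then show ?thesis by (intro isCont_of_locally_const[of "{..<a}" _ W UL]) (auto simp: out)
    next
      case 2
      then show ?thesis by (intro seg(2)) simp
    next
      case 5
      then show ?thesis by (intro seg(4)) simp
    next
      case 3
      then show ?thesis by (intro isCont_of_locally_const[of "{b<..<0}" _ W Ml]) (auto simp: inn)
    next
      case 4
      then show ?thesis by (intro isCont_of_locally_const[of "{0<..<c}" _ W Mr]) (auto simp: inn)
    next
      case 6
      then show ?thesis by (intro isCont_of_locally_const[of "{d<..}" _ W UR]) (auto simp: out)
    qed
  qed
  then show "\<xi> \<notin> {a, b, 0, c, d} \<Longrightarrow> isCont W \<xi>" .
  have "range W \<subseteq> {UL, Ml, Mr, UR, W 0} \<union> W ` {a..b} \<union> W ` {c..d}"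
  proof
    fix y assume "y \<in> range W"
    then obtain \<xi> where y: "y = W \<xi>" by blast
    consider "\<xi> < a" | "\<xi> \<in> {a..b}" | "b < \<xi>" "\<xi> < 0" | "\<xi> = 0" | "0 < \<xi>" "\<xi> < c" | "\<xi> \<in> {c..d}" | "d < \<xi>"
      by force
    then show "y \<in> {UL, Ml, Mr, UR, W 0} \<union> W ` {a..b} \<union> W ` {c..d}"
      unfolding y by cases (auto simp: out inn)
  qed
  moreover have "bounded ({UL, Ml, Mr, UR, W 0} \<union> W ` {a..b} \<union> W ` {c..d})"
    using seg by (simp add: finite_imp_bounded)
  ultimately show "bounded (range W)" using bounded_subset by blast
  show "W \<in> borel_measurable borel"
  proof (rule borel_measurable_continuous_countable_exceptions[where X = "{a, b, 0, c, d}"])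
    show "continuous_on (- {a, b, 0, c, d}) W" using cont by (intro continuous_at_imp_continuous_on) blast
  qed simp
qed

section \<open>The maximum wave speed\<close>

lemma is_max_wave_speed_exists:
  assumes "bounds_waves UL UR U l"
  shows "\<exists>s. is_max_wave_speed UL UR U s \<and> s \<le> l"
proof -
  let ?A = "{l. bounds_waves UL UR U l}"
  define m where "m = Inf ?A"
  have nonneg: "0 \<le> k" if "bounds_waves UL UR U k" for k
    using that unfolding bounds_waves_def by blast
  have state: "x < - k * t \<Longrightarrow> U x t = UL" "k * t < x \<Longrightarrow> U x t = UR"
    if "bounds_waves UL UR U k" "0 < t" for k x t
    using that unfolding bounds_waves_def by blast+
  have bb: "bdd_below ?A" by (rule bdd_belowI[of _ 0]) (simp add: nonneg)
  have ne: "?A \<noteq> {}" using assms by blast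
  have le: "m \<le> k" if "bounds_waves UL UR U k" for k unfolding m_def by (rule cInf_lower) (use that bb in auto)
  have near: "\<exists>k. bounds_waves UL UR U k \<and> k < y" if "m < y" for y
    using cInf_lessD[OF ne that[unfolded m_def]] by blast
  have "bounds_waves UL UR U m"
    unfolding bounds_waves_def[of _ _ _ m]
  proof (intro conjI allI impI)
    show "0 \<le> m" unfolding m_def using ne by (intro cInf_greatest) (simp_all add: nonneg)
    fix x t :: real assume t: "0 < t"
    show "U x t = UL" if "x < - m * t"
    proof -
      have "m < - x / t" unfolding pos_less_divide_eq[OF t] using that by simp
      then obtain k where k: "bounds_waves UL UR U k" "k < - x / t" using near by blast
      then have "x < - k * t" unfolding pos_less_divide_eq[OF t] by simp
      then show ?thesis by (rule state(1)[OF k(1) t])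
    qed
    show "U x t = UR" if "m * t < x"
    proof -
      have "m < x / t" using that t by (simp add: pos_less_divide_eq)
      then obtain k where k: "bounds_waves UL UR U k" "k < x / t" using near by blast
      then have "k * t < x" using t by (simp add: pos_less_divide_eq)
      then show ?thesis by (rule state(2)[OF k(1) t])
    qed
  qed
  then show ?thesis using le assms unfolding is_max_wave_speed_def by blast
qed

theorem lemmaB1:
  fixes \<rho>L \<rho>R vL vR ErL ErR EL ER pL pR ps :: real
    and U :: "real \<Rightarrow> real \<Rightarrow> state"
  assumes "0 < \<rho>L" and "0 < \<rho>R" and "0 < ErL" and "0 < ErR"
    and "EL = ErL + (1/2) * \<rho>L * vL\<^sup>2" and "ER = ErR + (1/2) * \<rho>R * vR\<^sup>2"
    and "pL = (1/3) * ErL" and "pR = (1/3) * ErR"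
    and "ps = pstar \<rho>L vL pL \<rho>R vR pR"
    and "riemann_solution (\<rho>L, vL, EL) (\<rho>R, vR, ER) U"
  shows "\<exists>s. is_max_wave_speed (\<rho>L, vL, EL) (\<rho>R, vR, ER) U s \<and>
             s \<le> max (- lambda_L_minus \<rho>L pL ps) (lambda_R_plus \<rho>R pR ps)"
proof -
  define UL UR where "UL = (\<rho>L, vL, EL)" and "UR = (\<rho>R, vR, ER)"
  have prim: "density UL = \<rho>L" "velocity UL = vL" "rad_pressure UL = pL"
    "density UR = \<rho>R" "velocity UR = vR" "rad_pressure UR = pR"
    using assms by (simp_all add: UL_def UR_def)
  have pos: "0 < density UL" "0 < rad_pressure UL" "0 < density UR" "0 < rad_pressure UR"
    using assms prim by auto
  have "riemann_solution UL UR U" using assms(10) by (simp only: UL_def UR_def)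
  then obtain W where weak: "weak_solution U (riemann_data UL UR)"
    and selfsim: "\<forall>x t. 0 < t \<longrightarrow> U x t = W (x / t)" and struct: "riemann_structure UL UR W"
    unfolding riemann_solution_def by (elim conjE exE)
  have U: "U x t = W (x / t)" if "0 < t" for x t using selfsim that by blast
  from struct obtain a b c d Ml Mr where ab: "a < 0" "a \<le> b" "b \<le> 0" and cd: "0 \<le> c" "c \<le> d" "0 < d"
    and out: "\<forall>\<xi>. \<xi> < a \<longrightarrow> W \<xi> = UL" "\<forall>\<xi>. d < \<xi> \<longrightarrow> W \<xi> = UR"
    and inn: "\<forall>\<xi>. b < \<xi> \<and> \<xi> < 0 \<longrightarrow> W \<xi> = Ml" "\<forall>\<xi>. 0 < \<xi> \<and> \<xi> < c \<longrightarrow> W \<xi> = Mr"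
    and waves: "admissible_shock a b UL Ml \<or> rarefaction W a b UL Ml"
      "admissible_shock c d UR Mr \<or> rarefaction W c d Mr UR"
    and dens: "density Ml = density UL" "density Mr = density UR"
    and pres: "0 \<le> rad_pressure Ml" "0 \<le> rad_pressure Mr" and vel: "velocity Ml \<le> velocity Mr"
    unfolding riemann_structure_def by (elim conjE exE)
  note reg = riemann_structure_regular[OF ab cd out inn waves]
  obtain B where "weak_profile (\<lambda>s. conserved (W s)) (\<lambda>s. flux (W s)) B"
    using weak_profile_of_solution[OF weak selfsim reg(3,2)] by blast
  then interpret state_profile W B "{a, b, 0, c, d}"
    unfolding state_profile_def state_profile_axioms_def using reg(1) by auto
  note L = left_wave[OF ab out(1) inn(1) waves(1) dens(1) pos(1,2) pres(1)]
  note R = right_wave[OF cd out(2) inn(2) waves(2) dens(2) pos(3,4) pres(2)]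
  have "flux Mr - flux Ml = 0 *\<^sub>R (conserved Mr - conserved Ml)"
    by (rule rankine_hugoniot[OF L(3) R(3)])
  then have "flux Mr = flux Ml" by simp
  then have contact: "rad_pressure Mr = rad_pressure Ml"
    "velocity Mr * rad_pressure Ml = velocity Ml * rad_pressure Ml"
    unfolding primitive_eqs(2,5) by auto
  let ?p = "rad_pressure Ml"
  \<comment> \<open>By the two wave relations, \<open>phi\<close> measures the velocity jump at the contact.\<close>
  have phi: "phi \<rho>L vL pL \<rho>R vR pR ?p = velocity Mr - velocity Ml"
    using L(1) R(1) unfolding prim contact(1) by (simp add: phi_def)
  have "ps = ?p"
    unfolding assms(9)
  proof (rule pstar_eqI)
    show "phi \<rho>L vL pL \<rho>R vR pR ?p = 0" if "0 < ?p" using that contact(2) phi by simp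
    show "0 \<le> phi \<rho>L vL pL \<rho>R vR pR 0" if "?p = 0" using vel phi that by simp
  qed (use pos prim pres in auto)
  then have left: "\<And>\<xi>. \<xi> < lambda_L_minus \<rho>L pL ps \<Longrightarrow> W \<xi> = UL"
    and right: "\<And>\<xi>. lambda_R_plus \<rho>R pR ps < \<xi> \<Longrightarrow> W \<xi> = UR"
    using L(2) R(2) unfolding prim contact(1) by simp_all
  let ?l = "max (- lambda_L_minus \<rho>L pL ps) (lambda_R_plus \<rho>R pR ps)"
  have "bounds_waves UL UR U ?l"
    unfolding bounds_waves_def
  proof (intro conjI allI impI)
    have "0 \<le> lambda_R_plus \<rho>R pR ps" using pos prim by (simp add: lambda_R_plus_def)
    then show "0 \<le> ?l" by linarith
    fix x t :: real assume t: "0 < t"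
    show "U x t = UL" if "x < - ?l * t"
    proof -
      have "x / t < - ?l" unfolding pos_divide_less_eq[OF t] by (rule that)
      then show ?thesis unfolding U[OF t] by (intro left) linarith
    qed
    show "U x t = UR" if "?l * t < x"
    proof -
      have "?l < x / t" unfolding pos_less_divide_eq[OF t] by (rule that)
      then show ?thesis unfolding U[OF t] by (intro right) linarith
    qed
  qed
  from is_max_wave_speed_exists[OF this] show ?thesis unfolding UL_def UR_def .
qed

end
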